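(* Consider the setting and assumptions described in the context (spaces $U_i,U,Y,W,X$, operators $A,B,\mathcal G,S$, $g=\mathcal G\circ S$, functionals $J_i^1,J_i^2$, cone $K$, strategy sets $U_{ad}^i$). (a) Let $u\in U_{ad}$ be a Nash equilibrium, i.e. for every $i$, $\mathcal G(S(u))\in K$ and $u_i$ minimizes $v_i\mapsto J_i^1(S(v_i,u_{-i}))+J_i^2(v_i)$ over all $v_i\in U_{ad}^i$ with $\mathcal G(S(v_i,u_{-i}))\in K$. Let $y=S(u)$ and assume $$\big(D\mathcal G(y)\,DA(y)^{-1}B_i\big)U_{ad}^i(u_i)-K(\mathcal G(y))=X\qquad\text{for all } i=1,\dots,N.$$ Then there exist $p_i\in W^*$, $\mu_i\in X^*$, $\lambda_i\in U_i^*$ for $i=1,\dots,N$ with $$0=DJ_i^2(u_i)+B_i^*p_i+\lambda_i\ \text{ in }U_i^*,\qquad A(y)=f+Bu\ \text{ in }W,\qquad DA(y)^*p_i=DJ_i^1(y)-D\mathcal G(y)^*\mu_i\ \text{ in }Y^*,$$ $$\lambda_i\in N_{U_{ad}^i}(u_i),\qquad \mu_i\in K^+,\quad \mathcal G(y)\in K,\quad\langle\mu_i,\mathcal G(y)\rangle=0 .$$ (b) Let $u\in U_{ad}$ be a variational equilibrium, i.e. $u\in\mathcal F$ and $u$ minimizes $v\mapsto\sum_{i=1}^N\big(J_i^1(S(v_i,u_{-i}))+J_i^2(v_i)\big)$ over $v\in\mathcal F$. Let $y=S(u)$ and assume $$\big(D\mathcal G(y)\,DA(y)^{-1}B\big)U_{ad}(u)-K(\mathcal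 G(y))=X .$$ Then there exist $p_i\in W^*$, $\lambda_i\in U_i^*$ for $i=1,\dots,N$ and a single $\mu\in X^*$ with $$0=DJ_i^2(u_i)+B_i^*p_i+\lambda_i\ \text{ in }U_i^*,\qquad A(y)=f+Bu\ \text{ in }W,\qquad DA(y)^*p_i=DJ_i^1(y)-D\mathcal G(y)^*\mu\ \text{ in }Y^*,$$ $$\lambda_i\in N_{U_{ad}^i}(u_i),\qquad \mu\in K^+,\quad \mathcal G(y)\in K,\quad\langle\mu,\mathcal G(y)\rangle=0 .$$
   Context: Setting and standing assumptions. All Banach spaces are real. $U_1,\dots,U_N$ are reflexive, separable Banach spaces, $U=\prod_{i=1}^N U_i$ with the product topology; $Y,W$ are reflexive Banach spaces; $X$ is a Banach space; $Y\hookrightarrow X$ is a continuous embedding. $A:Y\to W$ is bijective and continuously Fréchet differentiable; $DA(y)\in\mathcal L(Y,W)$ is invertible for all $y\in Y$ and $y\mapsto DA(y)^{-1}$ maps bounded sets to bounded sets. $f\in W$; $B\in\mathcal L(U,W)$, and $B_i\in\mathcal L(U_i,W)$ is $B_iu_i=B(u_i,0_{-i})$. $S=A^{-1}(f+B\,\cdot):U\to Y$ is completely continuous (maps weakly convergent sequences to strongly convergent ones, with corresponding limits). $K\subseteq X$ is a nonempty, closed, convex cone. $\mathcal G:Y\to X$ is continuously Fréchet differentiable, and $g=\mathcal G\circ S:U\to X$. The sets $U_{ad}^i\subset U_i$ are nonempty, bounded, closed, convex, $U_{ad}=\prod_iU_{ad}^i$, and $\mathcal F=\{u\in U_{ad}:g(u)\in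 K\}$ is nonempty. $J_i^1:Y\to\mathbb R$ is completely continuous, $J_i^2:U_i\to\mathbb R$ is continuous and weakly lower semicontinuous; all of these are bounded from below and continuously Fréchet differentiable; $DJ_i^2:U_i\to U_i^*$ has a weak-weak$^*$ closed graph. Notation. $(v_i,u_{-i})$ is $u$ with $i$-th component replaced by $v_i$; $T^*$ is the adjoint of $T$. For convex $C$ and $x\in C$, $C(x)=\{\alpha(c-x):c\in C,\alpha\ge0\}$ (used for $U_{ad}^i(u_i)$, $U_{ad}(u)$). For the cone $K$ and $x\in X$, $K(x)=\{k-\beta x:k\in K,\beta\ge0\}$. $K^+=\{x^*\in X^*:\langle x^*,k\rangle\ge0\ \forall k\in K\}$. $N_C(x)=\{x^*:\langle x^*,x'-x\rangle\le0\ \forall x'\in C\}$. *)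

theory Defs
  imports "HOL-Analysis.Analysis"
begin

text \<open>
  A family of Banach spaces indexed by a finite type \<open>'n\<close> is represented by closed linear
  subspaces \<open>E i\<close> of one ambient Banach space \<open>'e\<close>. Every finite family of Banach spaces arises
  this way up to isometry, as the coordinate subspaces of its product. Each \<open>E i\<close> is treated as
  a space in its own right: its topology is the relative norm topology, and its dual, weak
  topology and derivatives are formed inside \<open>E i\<close>, the ambient space playing no role. For
  functions on such a space only the values on it are relevant. With \<open>V = UNIV\<close> the notions
  below are the usual ones on the whole type.
\<close>

definition bounded_linear_on ::
    "'a::real_normed_vector set \<Rightarrow> ('a \<Rightarrow> 'b::real_normed_vector) \<Rightarrow> bool" where
  "bounded_linear_on V T \<longleftrightarrow>
     (\<forall>x\<in>V. \<forall>z\<in>V. T (x + z) = T x + T z) \<and>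
     (\<forall>c. \<forall>x\<in>V. T (c *\<^sub>R x) = c *\<^sub>R T x) \<and>
     (\<exists>M. \<forall>x\<in>V. norm (T x) \<le> norm x * M)"

definition dual_on :: "'a::real_normed_vector set \<Rightarrow> ('a \<Rightarrow> real) set" where
  "dual_on V = {\<phi>. bounded_linear_on V \<phi>}"

definition dual_norm_on :: "'a::real_normed_vector set \<Rightarrow> ('a \<Rightarrow> real) \<Rightarrow> real" where
  "dual_norm_on V \<phi> = (SUP x\<in>{x\<in>V. norm x \<le> 1}. \<bar>\<phi> x\<bar>)"

text \<open>
  Surjectivity of the canonical embedding into the bidual. The bound on \<open>\<Phi>\<close> forces it to depend
  only on the restriction of its argument to \<open>V\<close>.
\<close>

definition reflexive_on :: "'a::real_normed_vector set \<Rightarrow> bool" where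
  "reflexive_on V \<longleftrightarrow>
     (\<forall>\<Phi>. (\<forall>\<phi>\<in>dual_on V. \<forall>\<psi>\<in>dual_on V. \<Phi> (\<lambda>x. \<phi> x + \<psi> x) = \<Phi> \<phi> + \<Phi> \<psi>) \<and>
          (\<forall>c. \<forall>\<phi>\<in>dual_on V. \<Phi> (\<lambda>x. c * \<phi> x) = c * \<Phi> \<phi>) \<and>
          (\<exists>M. \<forall>\<phi>\<in>dual_on V. \<bar>\<Phi> \<phi>\<bar> \<le> dual_norm_on V \<phi> * M)
        \<longrightarrow> (\<exists>x\<in>V. \<forall>\<phi>\<in>dual_on V. \<Phi> \<phi> = \<phi> x))"

definition weakly_converges_on ::
    "'a::real_normed_vector set \<Rightarrow> (nat \<Rightarrow> 'a) \<Rightarrow> 'a \<Rightarrow> bool" where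
  "weakly_converges_on V s x \<longleftrightarrow>
     (\<forall>k. s k \<in> V) \<and> x \<in> V \<and> (\<forall>\<phi>\<in>dual_on V. (\<lambda>k. \<phi> (s k)) \<longlonglongrightarrow> \<phi> x)"

definition completely_continuous_on ::
    "'a::real_normed_vector set \<Rightarrow> ('a \<Rightarrow> 'b::real_normed_vector) \<Rightarrow> bool" where
  "completely_continuous_on V F \<longleftrightarrow>
     (\<forall>s x. weakly_converges_on V s x \<longrightarrow> (\<lambda>k. F (s k)) \<longlonglongrightarrow> F x)"

text \<open>
  Weak lower semicontinuity and weak-weak* closedness of a graph are sequential here; the
  versions for the weak topologies imply these.
\<close>

definition weakly_lsc_on :: "'a::real_normed_vector set \<Rightarrow> ('a \<Rightarrow> real) \<Rightarrow> bool" where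
  "weakly_lsc_on V F \<longleftrightarrow>
     (\<forall>s x. weakly_converges_on V s x \<longrightarrow> ereal (F x) \<le> liminf (\<lambda>k. ereal (F (s k))))"

definition has_frechet_derivative_on ::
    "'a::real_normed_vector set \<Rightarrow> ('a \<Rightarrow> 'b::real_normed_vector) \<Rightarrow> ('a \<Rightarrow> 'b) \<Rightarrow> 'a \<Rightarrow> bool" where
  "has_frechet_derivative_on V F F' x \<longleftrightarrow>
     bounded_linear_on V F' \<and>
     ((\<lambda>h. (F (x + h) - F x - F' h) /\<^sub>R norm h) \<longlongrightarrow> 0) (at 0 within V)"

definition continuously_differentiable_on ::
    "'a::real_normed_vector set \<Rightarrow> ('a \<Rightarrow> real) \<Rightarrow> ('a \<Rightarrow> 'a \<Rightarrow> real) \<Rightarrow> bool" where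
  "continuously_differentiable_on V F DF \<longleftrightarrow>
     (\<forall>x\<in>V. has_frechet_derivative_on V F (DF x) x) \<and>
     (\<forall>x\<in>V. ((\<lambda>z. dual_norm_on V (\<lambda>h. DF z h - DF x h)) \<longlongrightarrow> 0) (at x within V))"

definition weak_weakstar_closed_graph_on ::
    "'a::real_normed_vector set \<Rightarrow> ('a \<Rightarrow> 'a \<Rightarrow> real) \<Rightarrow> bool" where
  "weak_weakstar_closed_graph_on V D \<longleftrightarrow>
     (\<forall>s x. \<forall>\<phi>\<in>dual_on V.
        weakly_converges_on V s x \<and> (\<forall>h\<in>V. (\<lambda>k. D (s k) h) \<longlonglongrightarrow> \<phi> h)
        \<longrightarrow> (\<forall>h\<in>V. \<phi> h = D x h))"

definition prod_set :: "('n \<Rightarrow> 'e set) \<Rightarrow> ('e ^ 'n) set" where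
  "prod_set C = {u. \<forall>i. u $ i \<in> C i}"

text \<open>\<open>(v\<^sub>i, u\<^sub>-\<^sub>i)\<close>; the tuple \<open>(v\<^sub>i, 0\<^sub>-\<^sub>i)\<close> is the library's \<open>axis i v\<close>.\<close>

definition replace :: "'e ^ 'n \<Rightarrow> 'n \<Rightarrow> 'e \<Rightarrow> 'e ^ 'n" where
  "replace u i v = (\<chi> j. if j = i then v else u $ j)"

definition radial_cone :: "'a::real_vector set \<Rightarrow> 'a \<Rightarrow> 'a set" where
  "radial_cone C x = {\<alpha> *\<^sub>R (c - x) |\<alpha> c. c \<in> C \<and> 0 \<le> \<alpha>}"

definition cone_at :: "'a::real_vector set \<Rightarrow> 'a \<Rightarrow> 'a set" where
  "cone_at K x = {k - \<beta> *\<^sub>R x |k \<beta>. k \<in> K \<and> 0 \<le> \<beta>}"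

definition dual_cone :: "'a::real_normed_vector set \<Rightarrow> ('a \<Rightarrow>\<^sub>L real) set" where
  "dual_cone K = {\<mu>. \<forall>k\<in>K. 0 \<le> blinfun_apply \<mu> k}"

definition normal_cone_on ::
    "'a::real_normed_vector set \<Rightarrow> 'a set \<Rightarrow> 'a \<Rightarrow> ('a \<Rightarrow> real) set" where
  "normal_cone_on V C x = {\<phi> \<in> dual_on V. \<forall>z\<in>C. \<phi> (z - x) \<le> 0}"

text \<open>
  In the following, \<open>S\<close> maps strategies to states, \<open>g\<close> is the constraint map and player \<open>i\<close>
  has the objective \<open>J1 i (S u) + J2 i (u $ i)\<close>.
\<close>

definition feasible_set :: "('n \<Rightarrow> 'e set) \<Rightarrow> ('e ^ 'n \<Rightarrow> 'x) \<Rightarrow> 'x set \<Rightarrow> ('e ^ 'n) set" where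
  "feasible_set Uad g K = {u \<in> prod_set Uad. g u \<in> K}"

definition nash_equilibrium ::
    "('n \<Rightarrow> 'e set) \<Rightarrow> ('e ^ 'n \<Rightarrow> 'x) \<Rightarrow> 'x set \<Rightarrow> ('e ^ 'n \<Rightarrow> 'y) \<Rightarrow>
     ('n \<Rightarrow> 'y \<Rightarrow> real) \<Rightarrow> ('n \<Rightarrow> 'e \<Rightarrow> real) \<Rightarrow> 'e ^ 'n \<Rightarrow> bool" where
  "nash_equilibrium Uad g K S J1 J2 u \<longleftrightarrow>
     u \<in> prod_set Uad \<and>
     (\<forall>i. g u \<in> K \<and>
        is_arg_min (\<lambda>v. J1 i (S (replace u i v)) + J2 i v)
          (\<lambda>v. v \<in> Uad i \<and> g (replace u i v) \<in> K) (u $ i))"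

definition variational_equilibrium ::
    "('n::finite \<Rightarrow> 'e set) \<Rightarrow> ('e ^ 'n \<Rightarrow> 'x) \<Rightarrow> 'x set \<Rightarrow> ('e ^ 'n \<Rightarrow> 'y) \<Rightarrow>
     ('n \<Rightarrow> 'y \<Rightarrow> real) \<Rightarrow> ('n \<Rightarrow> 'e \<Rightarrow> real) \<Rightarrow> 'e ^ 'n \<Rightarrow> bool" where
  "variational_equilibrium Uad g K S J1 J2 u \<longleftrightarrow>
     is_arg_min (\<lambda>v. \<Sum>i\<in>UNIV. J1 i (S (replace u i (v $ i))) + J2 i (v $ i))
       (\<lambda>v. v \<in> feasible_set Uad g K) u"

lemma bounded_linear_on_UNIV: "bounded_linear_on UNIV T \<longleftrightarrow> bounded_linear T"
  unfolding bounded_linear_on_def bounded_linear_def bounded_linear_axioms_def linear_iff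
  by auto

lemma has_frechet_derivative_on_UNIV:
  "has_frechet_derivative_on UNIV F F' x \<longleftrightarrow> (F has_derivative F') (at x)"
  unfolding has_frechet_derivative_on_def bounded_linear_on_UNIV has_derivative_at
  by (subst tendsto_norm_zero_iff [symmetric]) (simp add: divide_inverse_commute)

end

theory Submission
  imports Defs
begin

text \<open>
  Both parts are instances of the Zowe--Kurcyusz multiplier rule. Writing the constraint
  \<open>g v \<in> K\<close> as \<open>g v - z = 0\<close> with \<open>(v, z)\<close> in the closed convex set \<open>D = C \<times> K\<close>, one minimizes
  \<open>\<phi>\<close> over \<open>{d \<in> D. F d = 0}\<close> where the derivative \<open>L\<close> of \<open>F\<close> maps the cone generated by
  \<open>D - d0\<close> onto the whole space. By Baire's theorem \<open>L\<close> maps the part of \<open>D - d0\<close> in the unit ball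
  densely into a neighbourhood of \<open>0\<close>, and a Newton type iteration inside \<open>D\<close> turns this into
  metric regularity of \<open>F\<close>. Hence \<open>\<phi>'\<close> is nonnegative on tangent directions in the kernel of \<open>L\<close>, so the
  value function of the linearized problem is a finite sublinear functional, and the multiplier is a linear
  functional below it. The adjoint state is \<open>p = (DJ\<^sub>1 - \<mu> \<circ> DG) \<circ> DA\<^sup>-\<^sup>1\<close>; in the variational case
  testing with tuples that differ from \<open>u\<close> in one component decouples the players.
\<close>

subsection \<open>Sublinear functionals\<close>

text \<open>Two obstacles shape the argument. \<open>K\<close> may have empty interior, so a Slater
  type separation is not at hand; and the qualification condition says only that the image of a cone
  is everything, which by itself puts no bound on preimages. The bound has to come from
  completeness, and the resulting regularity estimate serves twice: for \<open>F\<close>, to correct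
  a point on a linearized feasible direction to a feasible one, and for the affine map
  \<open>L (d - d0)\<close>, to make the multiplier continuous. The iteration compares
  \<open>F\<close> at two moving points, neither of which is \<open>d0\<close>, so the constraint is
  differentiated strictly; the objective is only expanded at \<open>d0\<close>, where an ordinary
  Frechet derivative does. Since \<open>D\<close> may have no interior, all these derivatives are
  relative to sets. For \<open>S\<close>, strictness is inherited from \<open>A\<close> by inverting
  the derivative. The linear functional below the value function is a minimal sublinear one, so
  nothing is extended from a subspace.\<close>

definition sublinear :: "('a::real_vector \<Rightarrow> real) \<Rightarrow> bool" where
  "sublinear p \<longleftrightarrow> (\<forall>x y. p (x + y) \<le> p x + p y) \<and> (\<forall>c>0. \<forall>x. p (c *\<^sub>R x) \<le> c * p x)"

lemma sublinear_add: "sublinear p \<Longrightarrow> p (x + y) \<le> p x + p y"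
  by (simp add: sublinear_def)

text \<open>Using the inequality for \<open>inverse c\<close> as well turns it into an equality. The
  definition can thus ask for \<open>\<le>\<close> only, which is what infima deliver
  directly.\<close>

lemma sublinear_scaleR:
  assumes "sublinear p" "0 < c"
  shows "p (c *\<^sub>R x) = c * p x"
proof -
  have "p (inverse c *\<^sub>R (c *\<^sub>R x)) \<le> inverse c * p (c *\<^sub>R x)"
    using assms unfolding sublinear_def by (meson positive_imp_inverse_positive)
  then have "c * p x \<le> p (c *\<^sub>R x)"
    using assms(2) by (simp add: field_simps)
  then show ?thesis
    using assms unfolding sublinear_def by (meson order_antisym)
qed

lemma sublinear_zero: "sublinear p \<Longrightarrow> p 0 = 0"
  using sublinear_scaleR[of p 2 0] by simp

lemma sublinear_minus: "sublinear p \<Longrightarrow> - p (- x) \<le> p x"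
  using sublinear_add[of p x "- x"] sublinear_zero[of p] by simp

text \<open>\<open>Z\<close> acts as a convex cone in the product with the reals, and the lower
  boundary of such a cone is sublinear. It is used for the shifted functional in the minimality
  argument, for the lower bound of a chain, and for the value function of the linearized
  problem.\<close>

lemma sublinear_Inf_fibre:
  fixes Z :: "'a::real_vector \<Rightarrow> real \<Rightarrow> bool"
  assumes add: "\<And>x y r s. Z x r \<Longrightarrow> Z y s \<Longrightarrow> Z (x + y) (r + s)"
    and scale: "\<And>c x r. 0 < c \<Longrightarrow> Z x r \<Longrightarrow> Z (c *\<^sub>R x) (c * r)"
    and ne: "\<And>x. \<exists>r. Z x r"
    and bd: "\<And>x. bdd_below {r. Z x r}"
  shows "sublinear (\<lambda>x. Inf {r. Z x r})"
  unfolding sublinear_def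
proof (intro conjI allI impI)
  fix x y
  have "Inf {r. Z (x + y) r} - s \<le> r" if "Z x r" "Z y s" for r s
    using cInf_lower[OF _ bd, of "r + s" "x + y"] add[OF that] by simp
  then have "Inf {r. Z (x + y) r} - s \<le> Inf {r. Z x r}" if "Z y s" for s
    using that ne[of x] by (intro cInf_greatest) auto
  then have "Inf {r. Z (x + y) r} - Inf {r. Z x r} \<le> s" if "Z y s" for s
    using that by (simp add: algebra_simps)
  then have "Inf {r. Z (x + y) r} - Inf {r. Z x r} \<le> Inf {r. Z y r}"
    using ne[of y] by (intro cInf_greatest) auto
  then show "Inf {r. Z (x + y) r} \<le> Inf {r. Z x r} + Inf {r. Z y r}"
    by simp
next
  fix c :: real and x
  assume c: "0 < c"
  have "Inf {r. Z (c *\<^sub>R x) r} / c \<le> r" if "Z x r" for r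
    using cInf_lower[OF _ bd, of "c * r" "c *\<^sub>R x"] scale[OF c that] c
    by (simp add: field_simps)
  then have "Inf {r. Z (c *\<^sub>R x) r} / c \<le> Inf {r. Z x r}"
    using ne[of x] by (intro cInf_greatest) auto
  then show "Inf {r. Z (c *\<^sub>R x) r} \<le> c * Inf {r. Z x r}"
    using c by (simp add: field_simps)
qed

text \<open>For fixed \<open>y\<close>, the infimum over \<open>t \<ge> 0\<close> of
  \<open>q (z + t *\<^sub>R y) - t * q y\<close> is sublinear in \<open>z\<close> and lies below
  \<open>q\<close> (take \<open>t = 0\<close>), so minimality makes it equal to \<open>q\<close>.
  The choice \<open>t = 1\<close> then gives \<open>q x + q y \<le> q (x + y)\<close>.\<close>

lemma minimal_sublinear_imp_linear:
  fixes q :: "'a::real_vector \<Rightarrow> real"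
  assumes q: "sublinear q"
    and minimal: "\<And>q'. sublinear q' \<Longrightarrow> (\<And>x. q' x \<le> q x) \<Longrightarrow> q' = q"
  shows "linear q"
proof -
  have additive: "q (x + y) = q x + q y" for x y
  proof -
    define Z where "Z z r \<longleftrightarrow> (\<exists>t\<ge>0. q (z + t *\<^sub>R y) - t * q y \<le> r)" for z r
    \<comment> \<open>A bound independent of \<open>t\<close>, from splitting
      \<open>t *\<^sub>R y\<close> as \<open>(z + t *\<^sub>R y) + (- z)\<close>; it keeps the
      infimum finite.\<close>
    have lower: "- q (- z) \<le> r" if zr: "Z z r" for z r
    proof -
      obtain t where t: "0 \<le> t" "q (z + t *\<^sub>R y) - t * q y \<le> r"
        using zr unfolding Z_def by blast
      have "q (t *\<^sub>R y) = t * q y"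
        using t(1) sublinear_scaleR[OF q] sublinear_zero[OF q] by (cases "t = 0") auto
      moreover have "q (t *\<^sub>R y) \<le> q (z + t *\<^sub>R y) + q (- z)"
        using sublinear_add[OF q, of "z + t *\<^sub>R y" "- z"] by (simp add: algebra_simps)
      ultimately show ?thesis
        using t(2) by simp
    qed
    have self: "Z z (q z)" for z
      unfolding Z_def by (rule exI[of _ 0]) simp
    have bd: "bdd_below {r. Z z r}" for z
      using lower by (intro bdd_belowI[of _ "- q (- z)"]) auto
    have "sublinear (\<lambda>z. Inf {r. Z z r})"
    proof (rule sublinear_Inf_fibre)
      fix x1 x2 r s
      assume "Z x1 r" "Z x2 s"
      then obtain t1 t2 where t: "0 \<le> t1" "0 \<le> t2"
        "q (x1 + t1 *\<^sub>R y) - t1 * q y \<le> r" "q (x2 + t2 *\<^sub>R y) - t2 * q y \<le> s"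
        unfolding Z_def by blast
      have "q ((x1 + x2) + (t1 + t2) *\<^sub>R y) \<le> q (x1 + t1 *\<^sub>R y) + q (x2 + t2 *\<^sub>R y)"
        using sublinear_add[OF q, of "x1 + t1 *\<^sub>R y" "x2 + t2 *\<^sub>R y"] by (simp add: algebra_simps)
      then have "q ((x1 + x2) + (t1 + t2) *\<^sub>R y) - (t1 + t2) * q y \<le> r + s"
        using t by (simp add: algebra_simps)
      then show "Z (x1 + x2) (r + s)"
        unfolding Z_def using t by (intro exI[of _ "t1 + t2"]) simp
    next
      fix c :: real and z r
      assume c: "0 < c" and "Z z r"
      then obtain t where t: "0 \<le> t" "q (z + t *\<^sub>R y) - t * q y \<le> r"
        unfolding Z_def by blast
      have "q (c *\<^sub>R z + (c * t) *\<^sub>R y) = c * q (z + t *\<^sub>R y)"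
        using sublinear_scaleR[OF q c, of "z + t *\<^sub>R y"] by (simp add: algebra_simps)
      then have "q (c *\<^sub>R z + (c * t) *\<^sub>R y) - (c * t) * q y \<le> c * r"
        using mult_left_mono[OF t(2), of c] c by (simp add: algebra_simps)
      then show "Z (c *\<^sub>R z) (c * r)"
        unfolding Z_def using t c by (intro exI[of _ "c * t"]) simp
    qed (use self bd in auto)
    then have "(\<lambda>z. Inf {r. Z z r}) = q"
      using self bd by (intro minimal) (auto intro: cInf_lower)
    then have "q x = Inf {r. Z x r}"
      by metis
    also have "\<dots> \<le> q (x + y) - q y"
      using bd by (intro cInf_lower) (auto simp: Z_def intro!: exI[of _ 1])
    finally show ?thesis
      using sublinear_add[OF q, of x y] by simp
  qed
  have neg: "q (- x) = - q x" for x
    using additive[of x "- x"] sublinear_zero[OF q] by simp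
  have "q (c *\<^sub>R x) = c * q x" for c x
  proof -
    consider "c > 0" | "c = 0" | "c < 0" by linarith
    then show ?thesis
    proof cases
      case 3
      then show ?thesis
        using sublinear_scaleR[OF q, of "- c" x] neg[of "c *\<^sub>R x"] by simp
    qed (use sublinear_scaleR[OF q] sublinear_zero[OF q] in auto)
  qed
  then show ?thesis
    using additive by (simp add: linear_iff)
qed

theorem Hahn_Banach_sublinear:
  fixes p :: "'a::real_vector \<Rightarrow> real"
  assumes p: "sublinear p"
  shows "\<exists>f. linear f \<and> (\<forall>x. f x \<le> p x)"
proof -
  define A where "A = {q. sublinear q \<and> (\<forall>x. q x \<le> p x)}"
  \<comment> \<open>The order is reversed: the maximal element that Zorn's lemma provides is a
    pointwise minimal functional.\<close>
  define P where "P q q' \<longleftrightarrow> (\<forall>x. q' x \<le> q x)" for q q' :: "'a \<Rightarrow> real"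
  have "\<exists>m\<in>A. \<forall>a\<in>A. P m a \<longrightarrow> a = m"
  proof (rule predicate_Zorn)
    show "partial_order_on A (relation_of P A)"
      by (rule partial_order_on_relation_ofI) (auto simp: P_def fun_eq_iff intro: order_trans order_antisym)
    fix C
    assume C: "C \<in> Chains (relation_of P A)"
    show "\<exists>u\<in>A. \<forall>a\<in>C. P a u"
    proof (cases "C = {}")
      case True
      then show ?thesis
        using p unfolding A_def by auto
    next
      case False
      have CA: "q \<in> A" if "q \<in> C" for q
        using C that unfolding Chains_def relation_of_def by blast
      have chain: "P q q' \<or> P q' q" if "q \<in> C" "q' \<in> C" for q q'
        using C that unfolding Chains_def relation_of_def by blast
      \<comment> \<open>The infimum over a fibre is the pointwise infimum of the chain. It is finite
        because every member satisfies \<open>- p (- x) \<le> - q (- x) \<le> q x\<close>.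
        Subadditivity needs a single member that is good at both arguments, which the chain property
        supplies.\<close>
      define Z where "Z x r \<longleftrightarrow> (\<exists>q\<in>C. q x \<le> r)" for x r
      have "- p (- x) \<le> r" if xr: "Z x r" for x r
      proof -
        obtain q where q: "q \<in> C" "q x \<le> r"
          using xr unfolding Z_def by blast
        then have "- q (- x) \<le> q x" "q (- x) \<le> p (- x)"
          using CA[of q] sublinear_minus[of q x] unfolding A_def by auto
        then show ?thesis
          using q by linarith
      qed
      then have bd: "bdd_below {r. Z x r}" for x
        by (intro bdd_belowI[of _ "- p (- x)"]) auto
      have low: "Inf {r. Z x r} \<le> q x" if "q \<in> C" for q x
        using that bd by (intro cInf_lower) (auto simp: Z_def)
      have "sublinear (\<lambda>x. Inf {r. Z x r})"
      proof (rule sublinear_Inf_fibre)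
        fix x y r s
        assume "Z x r" "Z y s"
        then obtain q1 q2 where q: "q1 \<in> C" "q2 \<in> C" "q1 x \<le> r" "q2 y \<le> s"
          unfolding Z_def by blast
        obtain q where "q \<in> C" "q x \<le> r" "q y \<le> s"
          using chain[OF q(1,2)] q unfolding P_def by (meson order_trans)
        moreover have "q (x + y) \<le> q x + q y"
          using CA[OF \<open>q \<in> C\<close>] sublinear_add unfolding A_def by auto
        ultimately show "Z (x + y) (r + s)"
          unfolding Z_def by (intro bexI[of _ q]) auto
      next
        fix c :: real and x r
        assume c: "0 < c" and "Z x r"
        then obtain q where "q \<in> C" "q x \<le> r"
          unfolding Z_def by blast
        then show "Z (c *\<^sub>R x) (c * r)"
          unfolding Z_def using c CA[of q] sublinear_scaleR[of q c x]
          by (intro bexI[of _ q]) (auto simp: A_def)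
      qed (use False bd in \<open>auto simp: Z_def\<close>)
      moreover have "Inf {r. Z x r} \<le> p x" for x
        using False low CA unfolding A_def by (fastforce intro: order_trans)
      ultimately show ?thesis
        using low unfolding A_def P_def by (intro bexI[of _ "\<lambda>x. Inf {r. Z x r}"]) auto
    qed
  qed
  then obtain m where m: "m \<in> A" "\<And>a. a \<in> A \<Longrightarrow> P m a \<Longrightarrow> a = m"
    by blast
  have "linear m"
    using m by (intro minimal_sublinear_imp_linear) (auto simp: A_def P_def intro: order_trans)
  then show ?thesis
    using m(1) unfolding A_def by auto
qed

subsection \<open>Linear maps and derivatives relative to a set\<close>

lemma bounded_linear_on_add:
  "bounded_linear_on V T \<Longrightarrow> x \<in> V \<Longrightarrow> z \<in> V \<Longrightarrow> T (x + z) = T x + T z"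
  by (simp add: bounded_linear_on_def)

lemma bounded_linear_on_scaleR:
  "bounded_linear_on V T \<Longrightarrow> x \<in> V \<Longrightarrow> T (c *\<^sub>R x) = c *\<^sub>R T x"
  by (simp add: bounded_linear_on_def)

lemma bounded_linear_on_diff:
  assumes "bounded_linear_on V T" "subspace V" "x \<in> V" "z \<in> V"
  shows "T (x - z) = T x - T z"
  using bounded_linear_on_add[OF assms(1,3), of "(-1) *\<^sub>R z"]
    bounded_linear_on_scaleR[OF assms(1,4), of "-1"] subspace_scale[OF assms(2,4), of "-1"]
  by simp

lemma bounded_linear_on_zero: "bounded_linear_on V T \<Longrightarrow> subspace V \<Longrightarrow> T 0 = 0"
  using bounded_linear_on_scaleR[of V T 0 0] subspace_0[of V] by simp

lemma bounded_linear_on_pos_bounded: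
  assumes "bounded_linear_on V T"
  obtains M where "0 < M" "\<And>x. x \<in> V \<Longrightarrow> norm (T x) \<le> M * norm x"
proof -
  obtain M where M: "\<forall>x\<in>V. norm (T x) \<le> norm x * M"
    using assms unfolding bounded_linear_on_def by blast
  have "norm (T x) \<le> max M 1 * norm x" if "x \<in> V" for x
    using M that mult_left_mono[of M "max M 1" "norm x"] by (fastforce simp: mult.commute)
  then show thesis
    using that[of "max M 1"] by simp
qed

text \<open>Both points vary, as in a Lipschitz estimate for the remainder \<open>F - L\<close> with
  arbitrarily small constant near \<open>x\<close>. \<open>L\<close> is evaluated only on
  differences of points of \<open>D\<close>, so linearity on a subspace containing them is
  enough.\<close>

definition strict_derivative_on ::
    "'a::real_normed_vector set \<Rightarrow> ('a \<Rightarrow> 'b::real_normed_vector) \<Rightarrow> ('a \<Rightarrow> 'b) \<Rightarrow> 'a \<Rightarrow> bool" where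
  "strict_derivative_on D F L x \<longleftrightarrow>
     (\<forall>\<epsilon>>0. \<exists>\<delta>>0. \<forall>d\<in>D. \<forall>d'\<in>D. norm (d - x) < \<delta> \<longrightarrow> norm (d' - x) < \<delta> \<longrightarrow>
        norm (F d' - F d - L (d' - d)) \<le> \<epsilon> * norm (d' - d))"

definition point_derivative_on ::
    "'a::real_normed_vector set \<Rightarrow> ('a \<Rightarrow> 'b::real_normed_vector) \<Rightarrow> ('a \<Rightarrow> 'b) \<Rightarrow> 'a \<Rightarrow> bool" where
  "point_derivative_on D F L x \<longleftrightarrow>
     (\<forall>\<epsilon>>0. \<exists>\<delta>>0. \<forall>d\<in>D. norm (d - x) < \<delta> \<longrightarrow>
        norm (F d - F x - L (d - x)) \<le> \<epsilon> * norm (d - x))"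

lemma strict_imp_point_derivative_on:
  assumes "strict_derivative_on D F L x" "x \<in> D"
  shows "point_derivative_on D F L x"
  using assms unfolding strict_derivative_on_def point_derivative_on_def
  by (metis diff_self norm_zero)

subsection \<open>Metric regularity and Lagrange multipliers\<close>

text \<open>Integer multiples of \<open>Q\<close> cover the space, so Baire puts a ball inside the
  closure of one of them, hence a ball around some \<open>b\<close> inside \<open>closure Q\<close>.
  As \<open>Q\<close> need not be symmetric, the ball is moved to the origin by absorbing
  \<open>- b\<close> and using convexity.\<close>

lemma convex_absorbing_closure_nhd:
  fixes Q :: "'a::banach set"
  assumes "convex Q" and absorbing: "\<And>y. \<exists>n>0. \<exists>q\<in>Q. y = real n *\<^sub>R q"
  obtains \<rho> where "0 < \<rho>" "cball 0 \<rho> \<subseteq> closure Q"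
proof -
  let ?C = "\<lambda>n. closure ((*\<^sub>R) (real (Suc n)) ` Q)"
  have "\<Union>(range ?C) = UNIV"
  proof -
    have "y \<in> \<Union>(range ?C)" for y
    proof -
      obtain n q where "n > 0" "q \<in> Q" "y = real n *\<^sub>R q"
        using absorbing by blast
      then have "y \<in> ?C (n - 1)"
        by (intro set_mp[OF closure_subset]) auto
      then show ?thesis by blast
    qed
    then show ?thesis by blast
  qed
  then have "\<exists>n. interior (?C n) \<noteq> {}"
    using Baire_category_alt[of "euclidean :: 'a topology" "range ?C"]
    by (force simp: completely_metrizable_space_euclidean)
  then obtain n a r where r: "0 < r" "ball a r \<subseteq> ?C n"
    by (metis all_not_in_conv mem_interior)
  define N where "N = real (Suc n)"
  have N: "N > 0" by (simp add: N_def)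
  have C: "?C n = (*\<^sub>R) N ` closure Q"
    unfolding N_def by (rule closure_scaleR[symmetric])
  define b s where "b = a /\<^sub>R N" and "s = r / N"
  have s: "s > 0" using r N by (simp add: s_def)
  have b: "b + z \<in> closure Q" if "norm z < s" for z
  proof -
    have "a + N *\<^sub>R z \<in> ball a r"
      using that N by (simp add: dist_norm s_def field_simps)
    then obtain q where "q \<in> closure Q" "a + N *\<^sub>R z = N *\<^sub>R q"
      using r C by blast
    moreover have "b + z = (a + N *\<^sub>R z) /\<^sub>R N"
      using N by (simp add: b_def scaleR_right_distrib)
    ultimately show ?thesis using N by simp
  qed
  obtain m q where m: "m > 0" "q \<in> Q" "- b = real m *\<^sub>R q"
    using absorbing by blast
  have ball: "z \<in> closure Q" if "norm z < s / (1 + m)" for z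
  proof -
    \<comment> \<open>The weights are chosen so that \<open>b\<close> cancels:
      \<open>- b = m q\<close> makes the second term equal to \<open>- b / (1 + m)\<close>, and what
      remains is \<open>z\<close>.\<close>
    have "(1 / (1 + real m)) *\<^sub>R (b + (1 + real m) *\<^sub>R z) + (real m / (1 + real m)) *\<^sub>R q \<in> closure Q"
    proof (rule convexD)
      show "b + (1 + real m) *\<^sub>R z \<in> closure Q"
        using that by (intro b) (simp add: pos_less_divide_eq mult.commute)
      show "q \<in> closure Q"
        using m closure_subset by blast
    qed (use \<open>convex Q\<close> in \<open>auto simp: convex_closure add_divide_distrib[symmetric]\<close>)
    moreover have "(real m / (1 + real m)) *\<^sub>R q = - ((1 / (1 + real m)) *\<^sub>R b)"
      using arg_cong[OF m(3), of "(*\<^sub>R) (1 / (1 + real m))"] by simp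
    ultimately show ?thesis
      by (simp add: scaleR_right_distrib)
  qed
  show thesis
  proof (rule that)
    \<comment> \<open>Halving the radius passes from an open ball to a closed one.\<close>
    define \<sigma> where "\<sigma> = s / (1 + real m)"
    have \<sigma>: "0 < \<sigma>" using s by (simp add: \<sigma>_def)
    then show "0 < \<sigma> / 2" by simp
    show "cball 0 (\<sigma> / 2) \<subseteq> closure Q"
    proof
      fix z :: 'a
      assume "z \<in> cball 0 (\<sigma> / 2)"
      then have "norm z < \<sigma>" using \<sigma> by simp
      then show "z \<in> closure Q" by (intro ball) (simp add: \<sigma>_def)
    qed
  qed
qed

text \<open>\<open>L_onto\<close> is the Zowe-Kurcyusz condition for an abstract convex set:
  \<open>L\<close> maps the cone generated by \<open>D - d0\<close> onto the target. Linearity is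
  asked on \<open>V\<close> only, since the strategy spaces are subspaces of an ambient
  space.\<close>

locale regular_point =
  fixes V D :: "'a::banach set" and L :: "'a \<Rightarrow> 'b::banach" and d0 :: 'a
  assumes subspace_V: "subspace V" and D_V: "D \<subseteq> V"
    and closed_D: "closed D" and convex_D: "convex D" and d0_D: "d0 \<in> D"
    and L: "bounded_linear_on V L"
    and L_onto: "\<And>y. \<exists>\<alpha>\<ge>0. \<exists>d\<in>D. y = L (\<alpha> *\<^sub>R (d - d0))"
begin

lemma diff_V: "d \<in> D \<Longrightarrow> d' \<in> D \<Longrightarrow> d - d' \<in> V"
  using D_V subspace_V by (blast intro: subspace_diff)

lemma segment_D: "d \<in> D \<Longrightarrow> d' \<in> D \<Longrightarrow> 0 \<le> t \<Longrightarrow> t \<le> 1 \<Longrightarrow> d + t *\<^sub>R (d' - d) \<in> D"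
  using convexD_alt[OF convex_D, of d d' t] by (simp add: algebra_simps)

text \<open>\<open>Q\<close> is the image of the part of \<open>D - d0\<close> in the unit ball. It
  is convex, and \<open>L_onto\<close> makes it absorbing once the representing vector has been
  shrunk into that ball.\<close>

lemma approximately_open:
  obtains \<rho> where "0 < \<rho>"
    "\<And>y \<epsilon>. norm y \<le> \<rho> \<Longrightarrow> 0 < \<epsilon> \<Longrightarrow> \<exists>d\<in>D. norm (d - d0) \<le> 1 \<and> norm (L (d - d0) - y) < \<epsilon>"
proof -
  define Q where "Q = (\<lambda>d. L (d - d0)) ` (D \<inter> cball d0 1)"
  have "convex Q"
  proof (rule convexI)
    fix x y and s t :: real
    assume xy: "x \<in> Q" "y \<in> Q" and st: "0 \<le> s" "0 \<le> t" "s + t = 1"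
    obtain d d' where d: "d \<in> D \<inter> cball d0 1" "d' \<in> D \<inter> cball d0 1"
      "x = L (d - d0)" "y = L (d' - d0)"
      using xy unfolding Q_def by blast
    have "s *\<^sub>R d + t *\<^sub>R d' \<in> D \<inter> cball d0 1"
      using d st convex_D by (intro convexD) (auto simp: convex_Int)
    moreover have "s *\<^sub>R d + t *\<^sub>R d' - d0 = s *\<^sub>R (d - d0) + t *\<^sub>R (d' - d0)"
      using st by (simp add: algebra_simps flip: scaleR_add_left)
    then have "L (s *\<^sub>R d + t *\<^sub>R d' - d0) = s *\<^sub>R x + t *\<^sub>R y"
      using d d0_D diff_V subspace_V bounded_linear_on_add[OF L] bounded_linear_on_scaleR[OF L]
      by (simp add: subspace_scale)
    ultimately show "s *\<^sub>R x + t *\<^sub>R y \<in> Q"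
      unfolding Q_def by (metis image_eqI)
  qed
  moreover have "\<exists>n>0. \<exists>q\<in>Q. y = real n *\<^sub>R q" for y
  proof -
    obtain \<alpha> d where a: "0 \<le> \<alpha>" "d \<in> D" "y = L (\<alpha> *\<^sub>R (d - d0))"
      using L_onto by blast
    \<comment> \<open>The three lower bounds give \<open>n > 0\<close>, a factor
      \<open>\<alpha> / n\<close> of at most 1, so that \<open>d'\<close> lies on a segment in
      \<open>D\<close>, and \<open>norm (d' - d0) \<le> 1\<close>.\<close>
    obtain n :: nat where n: "max 1 (max \<alpha> (\<alpha> * norm (d - d0))) < real n"
      using reals_Archimedean2 by blast
    define d' where "d' = d0 + (\<alpha> / n) *\<^sub>R (d - d0)"
    have "d' \<in> D"
      unfolding d'_def using a n by (intro segment_D d0_D) auto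
    moreover have "norm (d' - d0) \<le> 1"
      using a n by (simp add: d'_def divide_le_eq)
    ultimately have "L (d' - d0) \<in> Q"
      unfolding Q_def by (auto simp: dist_norm norm_minus_commute)
    moreover have "y = real n *\<^sub>R L (d' - d0)"
      using a n d0_D diff_V bounded_linear_on_scaleR[OF L] by (simp add: d'_def)
    ultimately show ?thesis
      using n by (intro exI[of _ n]) auto
  qed
  ultimately obtain \<rho> where \<rho>: "0 < \<rho>" "cball 0 \<rho> \<subseteq> closure Q"
    using convex_absorbing_closure_nhd by blast
  show thesis
  proof (rule that[OF \<rho>(1)])
    fix y :: 'b and \<epsilon> :: real
    assume "norm y \<le> \<rho>" "0 < \<epsilon>"
    then have "\<exists>q\<in>Q. dist q y < \<epsilon>"
      using \<rho>(2) by (auto simp: closure_approachable subset_iff)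
    then show "\<exists>d\<in>D. norm (d - d0) \<le> 1 \<and> norm (L (d - d0) - y) < \<epsilon>"
      unfolding Q_def by (auto simp: dist_norm norm_minus_commute)
  qed
qed

text \<open>
  A residual of norm \<open>\<rho> s\<close> is reduced by moving the fraction \<open>s\<close> of the way towards a point of \<open>D\<close>;
  this keeps the iterate in \<open>D\<close>, and since the linearized equation is solved only approximately,
  density of the image of \<open>L\<close> in a ball is all that Baire's theorem has to supply.
\<close>

lemma newton_step:
  assumes F: "strict_derivative_on D F L d0" and F0: "F d0 = 0"
  obtains \<eta> M where "0 < \<eta>" "0 < M"
    "\<And>d w. d \<in> D \<Longrightarrow> norm (d - d0) < \<eta> \<Longrightarrow> norm w \<le> \<eta> \<Longrightarrow> norm (F d - w) \<le> \<eta> \<Longrightarrow>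
       \<exists>d'\<in>D. norm (d' - d) \<le> M * norm (F d - w) \<and> norm (F d' - w) \<le> norm (F d - w) / 2"
proof -
  obtain \<rho> where \<rho>: "0 < \<rho>" and open_L:
    "\<And>y \<epsilon>. norm y \<le> \<rho> \<Longrightarrow> 0 < \<epsilon> \<Longrightarrow> \<exists>d\<in>D. norm (d - d0) \<le> 1 \<and> norm (L (d - d0) - y) < \<epsilon>"
    using approximately_open by blast
  obtain \<delta> where \<delta>: "0 < \<delta>" and strict: "\<And>d d'. d \<in> D \<Longrightarrow> d' \<in> D \<Longrightarrow> norm (d - d0) < \<delta> \<Longrightarrow>
      norm (d' - d0) < \<delta> \<Longrightarrow> norm (F d' - F d - L (d' - d)) \<le> \<rho> / 16 * norm (d' - d)"
    using F \<rho> unfolding strict_derivative_on_def by (metis divide_pos_pos zero_less_numeral)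
  \<comment> \<open>The entries serve in turn to bound \<open>e - d\<close> by 2, to keep
    \<open>d\<close> and then \<open>d'\<close> within \<open>\<delta>\<close> of \<open>d0\<close>,
    and to make \<open>s \<le> 1\<close> while \<open>r\<close> and \<open>w\<close> stay below
    \<open>\<rho> / 32\<close>. The final error is then at most \<open>5/16\<close> of
    \<open>\<rho> s = norm r\<close>.\<close>
  define \<eta> where "\<eta> = Min {1, \<delta> / 2, \<rho> * \<delta> / 8, \<rho> / 32}"
  have \<eta>: "0 < \<eta>" "\<eta> \<le> 1" "\<eta> \<le> \<delta> / 2" "\<eta> \<le> \<rho> * \<delta> / 8" "\<eta> \<le> \<rho> / 32"
    using \<rho> \<delta> by (auto simp: \<eta>_def)
  show thesis
  proof (rule that[of \<eta> "2 / \<rho>"])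
    fix d w
    assume d: "d \<in> D" "norm (d - d0) < \<eta>" and w: "norm w \<le> \<eta>" and res: "norm (F d - w) \<le> \<eta>"
    define r where "r = F d - w"
    define s where "s = norm r / \<rho>"
    have s0: "0 \<le> s" and sr: "norm r = \<rho> * s"
      using \<rho> by (auto simp: s_def)
    have s1: "s \<le> 1" and s\<delta>: "2 * s \<le> \<delta> / 4"
      using res \<eta> \<rho> by (auto simp: s_def r_def field_simps)
    \<comment> \<open>The target \<open>- r / s\<close> has norm \<open>\<rho>\<close>, so a step of
      length fraction \<open>s\<close> towards \<open>e\<close> approximately cancels
      \<open>r\<close>. If \<open>s = 0\<close> then \<open>r = 0\<close>, and division by zero
      gives the harmless target 0.\<close>
    obtain e where e: "e \<in> D" "norm (e - d0) \<le> 1" "norm (L (e - d0) + r /\<^sub>R s) \<le> \<rho> / 16"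
    proof -
      have "norm (- (r /\<^sub>R s)) \<le> \<rho>"
        using \<rho> s0 by (cases "s = 0") (auto simp: sr)
      then show thesis
        using open_L[of "- (r /\<^sub>R s)" "\<rho> / 16"] \<rho> that by fastforce
    qed
    define d' where "d' = d + s *\<^sub>R (e - d)"
    have "norm (e - d) \<le> norm (e - d0) + norm (d - d0)"
      using norm_triangle_ineq4[of "e - d0" "d - d0"] by simp
    then have ed: "norm (e - d) \<le> 2"
      using e d \<eta> by linarith
    have step: "norm (d' - d) \<le> 2 * s"
      using mult_left_mono[OF ed s0] s0 by (simp add: d'_def mult.commute)
    have d'D: "d' \<in> D"
      unfolding d'_def using d e s0 s1 by (intro segment_D) auto
    have "norm (d' - d0) \<le> norm (d' - d) + norm (d - d0)"
      using norm_triangle_ineq[of "d' - d" "d - d0"] by simp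
    then have near: "norm (d' - d0) < \<delta>" "norm (d - d0) < \<delta>"
      using step s\<delta> d \<eta> \<delta> by linarith+
    define err where "err = F d' - F d - L (d' - d)"
    \<comment> \<open>\<open>e\<close> solves the linearized equation from \<open>d0\<close>,
      whereas the step starts at \<open>d\<close>. By \<open>F d0 = 0\<close> the discrepancy
      \<open>L (d - d0)\<close> is \<open>r + w - err0\<close>, which is small and enters multiplied
      by \<open>s\<close>.\<close>
    define err0 where "err0 = F d - F d0 - L (d - d0)"
    have "norm err \<le> \<rho> / 16 * norm (d' - d)"
      unfolding err_def using strict d d'D near by blast
    also have "\<dots> \<le> \<rho> / 16 * (2 * s)"
      using step \<rho> by (intro mult_left_mono) auto
    finally have err: "norm err \<le> \<rho> * s / 8"
      by simp
    have "norm err0 \<le> \<rho> / 16 * norm (d - d0)"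
      unfolding err0_def using strict d0_D d near \<delta> by simp
    also have "\<dots> \<le> \<rho> / 16 * 1"
      using d \<eta> \<rho> by (intro mult_left_mono) auto
    finally have err0: "norm err0 \<le> \<rho> / 16"
      by simp
    have "L (e - d) = L (e - d0) - L (d - d0)"
      using bounded_linear_on_diff[OF L subspace_V, of "e - d0" "d - d0"] d e d0_D diff_V by simp
    moreover have "L (d' - d) = s *\<^sub>R L (e - d)"
      using d e diff_V bounded_linear_on_scaleR[OF L] by (simp add: d'_def)
    moreover have "s *\<^sub>R (r /\<^sub>R s) = r"
      using sr by (cases "s = 0") auto
    moreover have "L (d - d0) = r + w - err0"
      by (simp add: err0_def r_def F0)
    moreover have "F d' = err + (r + w) + L (d' - d)"
      by (simp add: err_def r_def)
    ultimately have "F d' - w = s *\<^sub>R (L (e - d0) + r /\<^sub>R s) + s *\<^sub>R (err0 - r - w) + err"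
      by (simp only: scaleR_right_distrib scaleR_right_diff_distrib) (simp add: algebra_simps)
    also have "norm \<dots> \<le> s * norm (L (e - d0) + r /\<^sub>R s) + s * norm (err0 - r - w) + norm err"
      by (rule norm_triangle_le, rule add_right_mono, rule norm_triangle_le) (use s0 in simp)
    also have "\<dots> \<le> s * (\<rho> / 16) + s * (\<rho> / 8) + \<rho> * s / 8"
    proof (intro add_mono mult_left_mono err e s0)
      have "norm (err0 - r - w) \<le> norm err0 + norm r + norm w"
        by (meson add_right_mono norm_triangle_ineq4 order_trans)
      then show "norm (err0 - r - w) \<le> \<rho> / 8"
        using err0 res w \<eta> unfolding r_def by linarith
    qed
    also have "\<dots> \<le> norm r / 2"
      using \<rho> s0 by (simp add: sr mult.commute)
    finally have "norm (F d' - w) \<le> norm (F d - w) / 2"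
      by (simp add: r_def)
    moreover have "norm (d' - d) \<le> 2 / \<rho> * norm (F d - w)"
      using step by (simp add: s_def r_def)
    ultimately show "\<exists>d'\<in>D. norm (d' - d) \<le> 2 / \<rho> * norm (F d - w) \<and>
        norm (F d' - w) \<le> norm (F d - w) / 2"
      using d'D by blast
  qed (use \<eta> \<rho> in auto)
qed

text \<open>A strict derivative with bounded \<open>L\<close> makes \<open>F\<close> Lipschitz near
  \<open>d0\<close>. This is what identifies the limit of the Newton iterates as a solution.\<close>

lemma strict_derivative_continuous:
  assumes "strict_derivative_on D F L d0"
  obtains \<delta> where "0 < \<delta>"
    "\<And>s d. (\<And>n. s n \<in> D) \<Longrightarrow> (\<And>n. norm (s n - d0) < \<delta>) \<Longrightarrow> d \<in> D \<Longrightarrow> norm (d - d0) < \<delta> \<Longrightarrow>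
       s \<longlonglongrightarrow> d \<Longrightarrow> (\<lambda>n. F (s n)) \<longlonglongrightarrow> F d"
proof -
  obtain M where M: "0 < M" "\<And>x. x \<in> V \<Longrightarrow> norm (L x) \<le> M * norm x"
    using bounded_linear_on_pos_bounded[OF L] by blast
  obtain \<delta> where \<delta>: "0 < \<delta>" and strict: "\<And>d d'. d \<in> D \<Longrightarrow> d' \<in> D \<Longrightarrow> norm (d - d0) < \<delta> \<Longrightarrow>
      norm (d' - d0) < \<delta> \<Longrightarrow> norm (F d' - F d - L (d' - d)) \<le> 1 * norm (d' - d)"
    using assms unfolding strict_derivative_on_def by (metis zero_less_one)
  show thesis
  proof (rule that[OF \<delta>])
    fix s d
    assume s: "\<And>n. s n \<in> D" "\<And>n. norm (s n - d0) < \<delta>" and d: "d \<in> D" "norm (d - d0) < \<delta>"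
      and lim: "s \<longlonglongrightarrow> d"
    have "norm (F (s n) - F d) \<le> norm (s n - d) * (1 + M)" for n
      using strict[OF d(1) s(1) d(2) s(2), of n] M(2)[OF diff_V[OF s(1) d(1)], of n]
        norm_triangle_sub[of "F (s n) - F d" "L (s n - d)"]
      by (simp add: algebra_simps)
    moreover have "(\<lambda>n. norm (s n - d) * (1 + M)) \<longlonglongrightarrow> 0"
      using lim by (intro tendsto_mult_left_zero tendsto_norm_zero LIM_zero)
    ultimately have "(\<lambda>n. F (s n) - F d) \<longlonglongrightarrow> 0"
      by (rule Lim_null_comparison[OF always_eventually[OF allI]])
    then show "(\<lambda>n. F (s n)) \<longlonglongrightarrow> F d"
      by (simp add: LIM_zero_iff)
  qed
qed

text \<open>Residuals halve and each step is at most \<open>M\<close> times the residual, so the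
  total displacement is a geometric series with sum \<open>2 * M * R\<close>. Both \<open>d\<close>
  and \<open>w\<close> vary: feasibility is restored from a general \<open>d\<close> with
  \<open>w = 0\<close>, while the bound on the multiplier starts from \<open>d0\<close> with general
  \<open>w\<close>.\<close>

theorem metric_regularity:
  assumes F: "strict_derivative_on D F L d0" and F0: "F d0 = 0"
  obtains \<delta> M where "0 < \<delta>" "0 < M"
    "\<And>d w. d \<in> D \<Longrightarrow> norm (d - d0) \<le> \<delta> \<Longrightarrow> norm w \<le> \<delta> \<Longrightarrow> norm (F d - w) \<le> \<delta> \<Longrightarrow>
       \<exists>d'\<in>D. F d' = w \<and> norm (d' - d) \<le> M * norm (F d - w)"
proof -
  obtain \<eta>0 M where \<eta>0: "0 < \<eta>0" and M: "0 < M" and newton: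
    "\<And>d w. d \<in> D \<Longrightarrow> norm (d - d0) < \<eta>0 \<Longrightarrow> norm w \<le> \<eta>0 \<Longrightarrow> norm (F d - w) \<le> \<eta>0 \<Longrightarrow>
       \<exists>d'\<in>D. norm (d' - d) \<le> M * norm (F d - w) \<and> norm (F d' - w) \<le> norm (F d - w) / 2"
    using newton_step[OF F F0] by blast
  obtain \<delta>0 where \<delta>0: "0 < \<delta>0" and cont:
    "\<And>s d. (\<And>n. s n \<in> D) \<Longrightarrow> (\<And>n. norm (s n - d0) < \<delta>0) \<Longrightarrow> d \<in> D \<Longrightarrow> norm (d - d0) < \<delta>0 \<Longrightarrow>
       s \<longlonglongrightarrow> d \<Longrightarrow> (\<lambda>n. F (s n)) \<longlonglongrightarrow> F d"
    using strict_derivative_continuous[OF F] by blast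
  define \<eta> where "\<eta> = min \<eta>0 \<delta>0"
  have \<eta>: "0 < \<eta>" "\<eta> \<le> \<eta>0" "\<eta> \<le> \<delta>0"
    using \<eta>0 \<delta>0 by (auto simp: \<eta>_def)
  \<comment> \<open>The start lies within \<open>\<eta> / 4\<close> of \<open>d0\<close> and the
    whole iteration travels at most \<open>2 * M * \<delta> \<le> \<eta> / 4\<close>, so no iterate
    leaves the region where \<open>newton\<close> applies.\<close>
  define \<delta> where "\<delta> = min (\<eta> / 4) (\<eta> / (8 * M))"
  have \<delta>: "0 < \<delta>" "\<delta> \<le> \<eta> / 4" "2 * M * \<delta> \<le> \<eta> / 4"
    using \<eta> M by (auto simp: \<delta>_def min_def field_simps)
  show thesis
  proof (rule that[of \<delta> "2 * M"])
    fix d w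
    assume d: "d \<in> D" "norm (d - d0) \<le> \<delta>" and w: "norm w \<le> \<delta>" and res: "norm (F d - w) \<le> \<delta>"
    define R where "R = norm (F d - w)"
    have R: "0 \<le> R" "R \<le> \<delta>"
      using res by (auto simp: R_def)
    then have R4: "2 * M * R \<le> \<eta> / 4"
      using \<delta>(3) M mult_left_mono[of R \<delta> "2 * M"] by linarith
    have near: "norm (e - d0) < \<eta>" if "norm (e - d) \<le> 2 * M * R" for e
      using norm_triangle_ineq[of "e - d" "d - d0"] that d \<delta> R4 \<eta> by simp
    \<comment> \<open>The factor \<open>2 * (1 - 1 / 2 ^ n)\<close> is the sum of the first
      \<open>n\<close> terms of the geometric series, so the distance bound is preserved exactly by
      adding one step.\<close>
    have "\<exists>s. \<forall>n. (s n \<in> D \<and> norm (F (s n) - w) \<le> R / 2 ^ n \<and>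
          norm (s n - d) \<le> 2 * M * R * (1 - 1 / 2 ^ n)) \<and>
        norm (s (Suc n) - s n) \<le> M * R / 2 ^ n"
    proof (rule dependent_nat_choice)
      show "\<exists>e. e \<in> D \<and> norm (F e - w) \<le> R / 2 ^ 0 \<and> norm (e - d) \<le> 2 * M * R * (1 - 1 / 2 ^ 0)"
        using d by (intro exI[of _ d]) (simp add: R_def)
    next
      fix e n
      assume e: "e \<in> D \<and> norm (F e - w) \<le> R / 2 ^ n \<and> norm (e - d) \<le> 2 * M * R * (1 - 1 / 2 ^ n)"
      have "2 * M * R * (1 - 1 / 2 ^ n) \<le> 2 * M * R * 1"
        using M R by (intro mult_left_mono) auto
      then have "norm (e - d0) < \<eta>"
        using e by (intro near) simp
      moreover have "R / 2 ^ n \<le> R"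
        using R by (simp add: divide_le_eq mult_le_cancel_left1)
      ultimately obtain e' where e': "e' \<in> D" "norm (e' - e) \<le> M * norm (F e - w)"
        "norm (F e' - w) \<le> norm (F e - w) / 2"
        using newton[of e w] e w \<eta> \<delta> R by auto
      have step: "norm (e' - e) \<le> M * R / 2 ^ n"
        using e' e M mult_left_mono[of "norm (F e - w)" "R / 2 ^ n" M] by simp
      have "norm (e' - d) \<le> M * R / 2 ^ n + 2 * M * R * (1 - 1 / 2 ^ n)"
        using norm_triangle_ineq[of "e' - e" "e - d"] e step by simp
      also have "\<dots> = 2 * M * R * (1 - 1 / 2 ^ Suc n)"
        by (simp add: field_simps)
      finally have "norm (e' - d) \<le> 2 * M * R * (1 - 1 / 2 ^ Suc n)" .
      moreover have "norm (F e' - w) \<le> R / 2 ^ Suc n"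
        using e' e by simp
      ultimately show "\<exists>e'. (e' \<in> D \<and> norm (F e' - w) \<le> R / 2 ^ Suc n \<and>
          norm (e' - d) \<le> 2 * M * R * (1 - 1 / 2 ^ Suc n)) \<and> norm (e' - e) \<le> M * R / 2 ^ n"
        using e' step by blast
    qed
    then obtain s where s: "\<And>n. s n \<in> D" "\<And>n. norm (F (s n) - w) \<le> R / 2 ^ n"
      "\<And>n. norm (s n - d) \<le> 2 * M * R * (1 - 1 / 2 ^ n)"
      "\<And>n. norm (s (Suc n) - s n) \<le> M * R / 2 ^ n"
      by blast
    have bound: "norm (s n - d) \<le> 2 * M * R" for n
    proof -
      have "2 * M * R * (1 - 1 / 2 ^ n) \<le> 2 * M * R * 1"
        using M R by (intro mult_left_mono) auto
      then show ?thesis using s(3)[of n] by simp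
    qed
    have "summable (\<lambda>n. s (Suc n) - s n)"
    proof (rule summable_comparison_test')
      show "summable (\<lambda>n. M * R * (1 / 2) ^ n)"
        by (intro summable_mult summable_geometric) simp
      show "norm (s (Suc n) - s n) \<le> M * R * (1 / 2) ^ n" if "n \<ge> 0" for n
        using s(4)[of n] by (simp add: power_one_over)
    qed
    then obtain l where "(\<lambda>n. s n - s 0) \<longlonglongrightarrow> l"
      by (auto simp: summable_iff_convergent convergent_def sum_lessThan_telescope)
    then have "(\<lambda>n. (s n - s 0) + s 0) \<longlonglongrightarrow> l + s 0"
      by (intro tendsto_intros)
    then obtain e where e: "s \<longlonglongrightarrow> e"
      by auto
    have eD: "e \<in> D"
      using closed_D s(1) e by (metis closed_sequentially)
    have ed: "norm (e - d) \<le> 2 * M * R"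
      using e bound by (intro LIMSEQ_le_const2[of "\<lambda>n. norm (s n - d)"])
        (auto intro!: tendsto_norm tendsto_diff)
    have "(\<lambda>n. F (s n)) \<longlonglongrightarrow> F e"
      using near[OF bound] near[OF ed] \<eta>(3) by (intro cont s eD e) (auto intro: less_le_trans)
    moreover have "(\<lambda>n. F (s n)) \<longlonglongrightarrow> w"
    proof -
      have "(\<lambda>n. R * (1 / 2) ^ n) \<longlonglongrightarrow> R * 0"
        by (intro tendsto_mult_left LIMSEQ_power_zero) simp
      then have "(\<lambda>n. R / 2 ^ n) \<longlonglongrightarrow> 0"
        by (simp add: power_one_over)
      then have "(\<lambda>n. F (s n) - w) \<longlonglongrightarrow> 0"
        by (rule Lim_null_comparison[OF always_eventually[OF allI[OF s(2)]]])
      then show ?thesis by (simp add: LIM_zero_iff)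
    qed
    ultimately have "F e = w"
      by (rule LIMSEQ_unique)
    then show "\<exists>d'\<in>D. F d' = w \<and> norm (d' - d) \<le> 2 * M * norm (F d - w)"
      using eD ed by (auto simp: R_def)
  qed (use \<delta> M in auto)
qed

text \<open>Suppose \<open>\<phi>'\<close> takes the value \<open>- c < 0\<close> on
  \<open>d - d0\<close>. The point \<open>e\<close> at parameter \<open>t\<close> on the segment has
  residual \<open>o(t)\<close>, and metric regularity moves it by \<open>o(t)\<close> to a feasible
  \<open>e'\<close>. There \<open>\<phi>\<close> has changed by \<open>- c * t + o(t)\<close>,
  contradicting minimality.\<close>

lemma point_derivative_nonneg_on_kernel:
  assumes F: "strict_derivative_on D F L d0" and F0: "F d0 = 0"
    and \<phi>': "bounded_linear_on V \<phi>'" and \<phi>: "point_derivative_on D \<phi> \<phi>' d0"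
    and minimal: "\<And>d. d \<in> D \<Longrightarrow> F d = 0 \<Longrightarrow> \<phi> d0 \<le> (\<phi> d :: real)"
    and d: "d \<in> D" "L (d - d0) = 0"
  shows "0 \<le> \<phi>' (d - d0)"
proof (rule ccontr)
  assume "\<not> 0 \<le> \<phi>' (d - d0)"
  define c where "c = - \<phi>' (d - d0)"
  have c: "c > 0"
    using \<open>\<not> 0 \<le> \<phi>' (d - d0)\<close> by (simp add: c_def)
  define h where "h = norm (d - d0) + 1"
  have h: "h > 0" "norm (d - d0) \<le> h"
    by (simp_all add: h_def add_nonneg_pos)
  obtain \<delta> M where \<delta>: "0 < \<delta>" and M: "0 < M" and reg:
    "\<And>d w. d \<in> D \<Longrightarrow> norm (d - d0) \<le> \<delta> \<Longrightarrow> norm w \<le> \<delta> \<Longrightarrow> norm (F d - w) \<le> \<delta> \<Longrightarrow>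
       \<exists>d'\<in>D. F d' = w \<and> norm (d' - d) \<le> M * norm (F d - w)"
    using metric_regularity[OF F F0] by blast
  obtain P where P: "0 < P" "\<And>x. x \<in> V \<Longrightarrow> \<bar>\<phi>' x\<bar> \<le> P * norm x"
    using bounded_linear_on_pos_bounded[OF \<phi>'] by (auto simp: real_norm_def)
  \<comment> \<open>The correction will have length at most \<open>\<kappa> * t\<close>, changing
    \<open>\<phi>'\<close> by at most a quarter of the gain \<open>c * t\<close>. The remainder of
    \<open>\<phi>\<close> takes another quarter, so half of the gain survives.\<close>
  define \<kappa> where "\<kappa> = min 1 (c / (4 * P))"
  have \<kappa>: "0 < \<kappa>" "\<kappa> \<le> 1" "P * \<kappa> \<le> c / 4"
    using c P by (auto simp: \<kappa>_def min_def field_simps)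
  have "0 < \<kappa> / (M * h)" "0 < c / (4 * (h + 1))"
    using \<kappa> M h c by (auto intro!: divide_pos_pos mult_pos_pos)
  obtain \<delta>1 where \<delta>1: "0 < \<delta>1" and F1: "\<And>d. d \<in> D \<Longrightarrow> norm (d - d0) < \<delta>1 \<Longrightarrow>
      norm (F d - F d0 - L (d - d0)) \<le> \<kappa> / (M * h) * norm (d - d0)"
    using strict_imp_point_derivative_on[OF F d0_D] \<open>0 < \<kappa> / (M * h)\<close>
    unfolding point_derivative_on_def by metis
  obtain \<delta>2 where \<delta>2: "0 < \<delta>2" and F2: "\<And>d. d \<in> D \<Longrightarrow> norm (d - d0) < \<delta>2 \<Longrightarrow>
      norm (\<phi> d - \<phi> d0 - \<phi>' (d - d0)) \<le> c / (4 * (h + 1)) * norm (d - d0)"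
    using \<phi> \<open>0 < c / (4 * (h + 1))\<close> unfolding point_derivative_on_def by metis
  \<comment> \<open>In order: \<open>e\<close> stays on the segment, within the regularity radius,
    and with residual \<open>\<kappa> * t / M\<close> below \<open>\<delta>\<close>; the last two
    put \<open>e\<close> and \<open>e'\<close> in reach of the derivative estimates, with a factor 2
    for strictness.\<close>
  define t where "t = Min {1, \<delta> / h, \<delta> * M / \<kappa>, \<delta>1 / (2 * h), \<delta>2 / (2 * (h + 1))}"
  have "t > 0"
    using \<delta> \<delta>1 \<delta>2 h M \<kappa> by (auto simp: t_def)
  have "t \<le> \<delta>2 / (2 * (h + 1))"
    by (simp add: t_def)
  then have "t * (2 * (h + 1)) \<le> \<delta>2"
    using h by (subst (asm) pos_le_divide_eq) auto
  with \<delta>2 have t2: "t * (h + 1) < \<delta>2"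
    by (simp add: algebra_simps)
  have "t \<le> 1" "t \<le> \<delta> / h" "t \<le> \<delta> * M / \<kappa>" "t \<le> \<delta>1 / (2 * h)"
    by (auto simp: t_def)
  then have t: "t \<le> 1" "t * h \<le> \<delta>" "\<kappa> * t \<le> \<delta> * M" "t * h < \<delta>1"
    using h M \<delta> \<delta>1 \<delta>2 \<kappa> by (auto simp: pos_le_divide_eq mult_ac)
  define e where "e = d0 + t *\<^sub>R (d - d0)"
  have eD: "e \<in> D"
    unfolding e_def using d d0_D t \<open>t > 0\<close> by (intro segment_D) auto
  have eh: "norm (e - d0) \<le> t * h"
    using h \<open>t > 0\<close> by (simp add: e_def)
  have "L (e - d0) = 0"
    using d diff_V[OF d(1) d0_D] bounded_linear_on_scaleR[OF L] by (simp add: e_def)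
  then have "norm (F e) \<le> \<kappa> / (M * h) * norm (e - d0)"
    using F1[OF eD] eh t F0 by simp
  also have "\<dots> \<le> \<kappa> / (M * h) * (t * h)"
    using eh \<open>0 < \<kappa> / (M * h)\<close> by (intro mult_left_mono) auto
  finally have Fe: "norm (F e) \<le> \<kappa> * t / M"
    using h by simp
  also have "\<dots> \<le> \<delta>"
    using t M by (simp add: divide_le_eq)
  finally obtain e' where e': "e' \<in> D" "F e' = 0" "norm (e' - e) \<le> M * norm (F e)"
    using reg[OF eD, of 0] eh t \<delta> by auto
  have dist: "norm (e' - e) \<le> \<kappa> * t"
    using e'(3) mult_left_mono[OF Fe, of M] M by simp
  also have "\<dots> \<le> 1 * t"
    using \<kappa> \<open>t > 0\<close> by (intro mult_right_mono) auto
  finally have e'h: "norm (e' - d0) \<le> t * (h + 1)"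
    using norm_triangle_ineq[of "e' - e" "e - d0"] eh by (simp add: algebra_simps)
  have "\<phi> e' - \<phi> d0 - \<phi>' (e' - d0) \<le> c / (4 * (h + 1)) * norm (e' - d0)"
    using F2[OF e'(1)] e'h t2 by simp
  also have "\<dots> \<le> c / (4 * (h + 1)) * (t * (h + 1))"
    using e'h \<open>0 < c / (4 * (h + 1))\<close> by (intro mult_left_mono) auto
  also have "\<dots> = c * t / 4"
  proof -
    have "c / (4 * k) * (t * k) = c * t / 4" if "k > 0" for k
      using that by simp
    then show ?thesis using h by (meson add_pos_pos zero_less_one)
  qed
  finally have "\<phi> e' - \<phi> d0 - \<phi>' (e' - d0) \<le> c * t / 4" .
  moreover have "\<phi>' (e' - d0) = \<phi>' (e' - e) + t * \<phi>' (d - d0)"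
    using bounded_linear_on_add[OF \<phi>', of "e' - e" "e - d0"] diff_V e' eD d0_D d
      bounded_linear_on_scaleR[OF \<phi>', of "d - d0" t] subspace_scale[OF subspace_V]
    by (simp add: e_def)
  moreover have "\<phi>' (e' - e) \<le> c * t / 4"
  proof -
    have "\<phi>' (e' - e) \<le> P * norm (e' - e)"
      using P(2)[OF diff_V[OF e'(1) eD]] by linarith
    also have "\<dots> \<le> P * (\<kappa> * t)"
      using dist P by (intro mult_left_mono) auto
    also have "\<dots> \<le> c / 4 * t"
      using mult_right_mono[OF \<kappa>(3), of t] \<open>t > 0\<close> by (simp add: mult_ac)
    finally show ?thesis by simp
  qed
  ultimately have "\<phi> e' - \<phi> d0 \<le> - (c * t / 2)"
    by (simp add: c_def algebra_simps)
  then show False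
    using minimal[OF e'(1,2)] mult_pos_pos[OF c \<open>t > 0\<close>] by simp
qed

text \<open>The conclusion is the variational inequality for the Lagrangian
  \<open>\<phi>' - \<mu> \<circ> L\<close> on \<open>D - d0\<close>. It follows from
  \<open>\<mu>\<close> lying below the value function, since \<open>\<phi>' (d - d0)\<close> is one
  of the values over which the infimum at \<open>L (d - d0)\<close> is taken.\<close>

theorem lagrange_multiplier:
  assumes F: "strict_derivative_on D F L d0" and F0: "F d0 = 0"
    and \<phi>': "bounded_linear_on V \<phi>'" and \<phi>: "point_derivative_on D \<phi> \<phi>' d0"
    and minimal: "\<And>d. d \<in> D \<Longrightarrow> F d = 0 \<Longrightarrow> \<phi> d0 \<le> (\<phi> d :: real)"
  obtains \<mu> :: "'b \<Rightarrow>\<^sub>L real" where "\<And>d. d \<in> D \<Longrightarrow> blinfun_apply \<mu> (L (d - d0)) \<le> \<phi>' (d - d0)"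
proof -
  \<comment> \<open>\<open>Inf {r. Z x r}\<close> is the value function of the linearized problem with right-hand side \<open>x\<close>.\<close>
  define Z where "Z x r \<longleftrightarrow> (\<exists>\<alpha>\<ge>0. \<exists>d\<in>D. x = L (\<alpha> *\<^sub>R (d - d0)) \<and> r = \<phi>' (\<alpha> *\<^sub>R (d - d0)))" for x r
  have V: "\<alpha> *\<^sub>R (d - d0) \<in> V" if "d \<in> D" for \<alpha> d
    using that d0_D diff_V subspace_V by (simp add: subspace_scale)
  have kernel: "0 \<le> r" if Z0: "Z 0 r" for r
  proof -
    obtain \<alpha> d where a: "0 \<le> \<alpha>" "d \<in> D" "0 = L (\<alpha> *\<^sub>R (d - d0))" "r = \<phi>' (\<alpha> *\<^sub>R (d - d0))"
      using Z0 unfolding Z_def by blast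
    have r: "r = \<alpha> * \<phi>' (d - d0)"
      using a(4) bounded_linear_on_scaleR[OF \<phi>' diff_V[OF a(2) d0_D], of \<alpha>] by simp
    show ?thesis
    proof (cases "\<alpha> = 0")
      case False
      then have "L (d - d0) = 0"
        using a(3) bounded_linear_on_scaleR[OF L diff_V[OF a(2) d0_D], of \<alpha>] by simp
      then have "0 \<le> \<phi>' (d - d0)"
        using minimal by (intro point_derivative_nonneg_on_kernel[OF F F0 \<phi>' \<phi> _ a(2)]) auto
      then show ?thesis using r a(1) by simp
    qed (simp add: r)
  qed
  have add: "Z (x + y) (r + s)" if Zx: "Z x r" and Zy: "Z y s" for x y r s
  proof -
    obtain \<alpha> d where a: "0 \<le> \<alpha>" "d \<in> D" "x = L (\<alpha> *\<^sub>R (d - d0))" "r = \<phi>' (\<alpha> *\<^sub>R (d - d0))"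
      using Zx unfolding Z_def by blast
    obtain \<beta> e where b: "0 \<le> \<beta>" "e \<in> D" "y = L (\<beta> *\<^sub>R (e - d0))" "s = \<phi>' (\<beta> *\<^sub>R (e - d0))"
      using Zy unfolding Z_def by blast
    have sum: "x + y = L (\<alpha> *\<^sub>R (d - d0) + \<beta> *\<^sub>R (e - d0))"
      "r + s = \<phi>' (\<alpha> *\<^sub>R (d - d0) + \<beta> *\<^sub>R (e - d0))"
      using a b V bounded_linear_on_add[OF L] bounded_linear_on_add[OF \<phi>'] by auto
    show ?thesis
    proof (cases "\<alpha> + \<beta> = 0")
      case True
      then have "\<alpha> = 0" "\<beta> = 0" using a b by auto
      then show ?thesis
        unfolding Z_def using sum d0_D by (intro exI[of _ 0] conjI bexI[of _ d0]) auto
    next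
      case False
      then have pos: "\<alpha> + \<beta> > 0" using a b by simp
      \<comment> \<open>Convexity of \<open>D\<close> merges the two rays into one, with the weights
        proportional to \<open>\<alpha>\<close> and \<open>\<beta>\<close>.\<close>
      define f where "f = (\<alpha> / (\<alpha> + \<beta>)) *\<^sub>R d + (\<beta> / (\<alpha> + \<beta>)) *\<^sub>R e"
      have "f \<in> D"
        unfolding f_def using a b pos
        by (intro convexD[OF convex_D]) (auto simp: add_divide_distrib[symmetric])
      moreover have "(\<alpha> + \<beta>) *\<^sub>R f = \<alpha> *\<^sub>R d + \<beta> *\<^sub>R e"
        unfolding f_def using pos by (simp add: scaleR_right_distrib)
      then have "(\<alpha> + \<beta>) *\<^sub>R (f - d0) = \<alpha> *\<^sub>R (d - d0) + \<beta> *\<^sub>R (e - d0)"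
        by (simp add: algebra_simps)
      ultimately show ?thesis
        unfolding Z_def using sum pos by (intro exI[of _ "\<alpha> + \<beta>"] conjI bexI[of _ f]) auto
    qed
  qed
  have scale: "Z (c *\<^sub>R x) (c * r)" if c: "0 < c" and Zx: "Z x r" for c x r
  proof -
    obtain \<alpha> d where a: "0 \<le> \<alpha>" "d \<in> D" "x = L (\<alpha> *\<^sub>R (d - d0))" "r = \<phi>' (\<alpha> *\<^sub>R (d - d0))"
      using Zx unfolding Z_def by blast
    then show ?thesis
      unfolding Z_def using c V bounded_linear_on_scaleR[OF L, of "\<alpha> *\<^sub>R (d - d0)" c]
        bounded_linear_on_scaleR[OF \<phi>', of "\<alpha> *\<^sub>R (d - d0)" c]
      by (intro exI[of _ "c * \<alpha>"] conjI bexI[of _ d]) auto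
  qed
  have ne: "\<exists>r. Z x r" for x
    using L_onto[of x] unfolding Z_def by blast
  have bd: "bdd_below {r. Z x r}" for x
  proof -
    obtain s where "Z (- x) s"
      using ne by blast
    \<comment> \<open>Any value over \<open>- x\<close> bounds all values over \<open>x\<close> from
      below: their sum is a value over 0, where \<open>kernel\<close> applies.\<close>
    then have "- s \<le> r" if "Z x r" for r
      using kernel[of "r + s"] add[OF that, of "- x" s] by simp
    then show ?thesis
      by (intro bdd_belowI[of _ "- s"]) auto
  qed
  obtain \<mu> where \<mu>: "linear \<mu>" "\<And>x. \<mu> x \<le> Inf {r. Z x r}"
    using Hahn_Banach_sublinear[OF sublinear_Inf_fibre[OF add scale ne bd]] by blast
  have le: "\<mu> x \<le> r" if "Z x r" for x r
    using \<mu>(2)[of x] cInf_lower[OF _ bd, of r x] that by simp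
  \<comment> \<open>Metric regularity of \<open>L\<close> itself bounds the value function, hence \<open>\<mu>\<close>, near \<open>0\<close>.\<close>
  obtain C where C: "\<And>x. \<mu> x \<le> C * norm x" "0 < C"
  proof -
    have "strict_derivative_on D (\<lambda>d. L (d - d0)) L d0"
      unfolding strict_derivative_on_def
    proof (intro allI impI exI[of _ 1] conjI ballI)
      fix \<epsilon> :: real and d d'
      assume "0 < \<epsilon>" "d \<in> D" "d' \<in> D"
      then show "norm (L (d' - d0) - L (d - d0) - L (d' - d)) \<le> \<epsilon> * norm (d' - d)"
        using bounded_linear_on_diff[OF L subspace_V, of "d' - d0" "d - d0"] d0_D diff_V by simp
    qed simp
    moreover have "L (d0 - d0) = 0"
      using bounded_linear_on_zero[OF L subspace_V] by simp
    ultimately obtain \<delta> M where \<delta>: "0 < \<delta>" and M: "0 < M" and reg: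
      "\<And>d w. d \<in> D \<Longrightarrow> norm (d - d0) \<le> \<delta> \<Longrightarrow> norm w \<le> \<delta> \<Longrightarrow> norm (L (d - d0) - w) \<le> \<delta> \<Longrightarrow>
        \<exists>d'\<in>D. L (d' - d0) = w \<and> norm (d' - d) \<le> M * norm (L (d - d0) - w)"
      using metric_regularity[of "\<lambda>d. L (d - d0)"] by blast
    obtain P where P: "0 < P" "\<And>x. x \<in> V \<Longrightarrow> \<bar>\<phi>' x\<bar> \<le> P * norm x"
      using bounded_linear_on_pos_bounded[OF \<phi>'] by (auto simp: real_norm_def)
    have small: "\<mu> w \<le> P * M * norm w" if w: "norm w \<le> \<delta>" for w
    proof -
      obtain d where d: "d \<in> D" "L (d - d0) = w" "norm (d - d0) \<le> M * norm w"
        using reg[OF d0_D, of w] w \<delta> \<open>L (d0 - d0) = 0\<close> by auto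
      have "Z w (\<phi>' (d - d0))"
        unfolding Z_def using d by (intro exI[of _ 1] conjI bexI[of _ d]) auto
      then have "\<mu> w \<le> P * norm (d - d0)"
        using le P(2)[OF diff_V[OF d(1) d0_D]] by fastforce
      also have "\<dots> \<le> P * (M * norm w)"
        using d P by (intro mult_left_mono) auto
      finally show ?thesis by simp
    qed
    have "\<mu> x \<le> P * M * norm x" for x
    proof (cases "x = 0")
      case True
      then show ?thesis using \<mu>(1) by (simp add: linear_0)
    next
      case False
      define c where "c = \<delta> / norm x"
      have c: "c > 0" using \<delta> False by (simp add: c_def)
      have "\<mu> (c *\<^sub>R x) \<le> P * M * norm (c *\<^sub>R x)"
        using False \<delta> by (intro small) (simp add: c_def)
      then have "c * \<mu> x \<le> c * (P * M * norm x)"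
        using c \<mu>(1) by (simp add: linear_cmul mult_ac)
      then show ?thesis using c by simp
    qed
    then show thesis using that P M by (meson mult_pos_pos)
  qed
  have "bounded_linear \<mu>"
  proof (rule bounded_linear_intro[where K = C])
    \<comment> \<open>For a linear functional the one-sided bound, applied to \<open>x\<close> and
      \<open>- x\<close>, is two-sided.\<close>
    show "norm (\<mu> x) \<le> norm x * C" for x
      using C(1)[of x] C(1)[of "- x"] \<mu>(1) by (simp add: linear_neg mult.commute abs_le_iff)
  qed (use \<mu>(1) in \<open>auto simp: linear_iff\<close>)
  then have app: "blinfun_apply (Blinfun \<mu>) = \<mu>"
    by (rule bounded_linear_Blinfun_apply)
  show thesis
  proof (rule that[of "Blinfun \<mu>"])
    fix d
    assume "d \<in> D"
    then have "Z (L (d - d0)) (\<phi>' (d - d0))"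
      unfolding Z_def by (intro exI[of _ 1] conjI bexI[of _ d]) auto
    then show "blinfun_apply (Blinfun \<mu>) (L (d - d0)) \<le> \<phi>' (d - d0)"
      using le app by simp
  qed
qed

end

subsection \<open>Calculus of relative derivatives\<close>

text \<open>The inner map is where a direction of one player is embedded by \<open>axis i\<close> or
  a component is extracted; the outer one is where derivatives on whole spaces are composed on. One
  rule thus serves all the linear maps of the game.\<close>

lemma bounded_linear_on_comp:
  assumes T: "bounded_linear_on V T" and N: "bounded_linear N"
    and \<iota>: "bounded_linear \<iota>" "\<And>x. x \<in> V' \<Longrightarrow> \<iota> x \<in> V"
  shows "bounded_linear_on V' (\<lambda>x. N (T (\<iota> x)))"
proof -
  obtain M where M: "0 < M" "\<And>x. x \<in> V \<Longrightarrow> norm (T x) \<le> M * norm x"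
    using bounded_linear_on_pos_bounded[OF T] by blast
  obtain K where K: "0 < K" "\<And>x. norm (N x) \<le> norm x * K"
    using bounded_linear.pos_bounded[OF N] by blast
  obtain K' where K': "0 < K'" "\<And>x. norm (\<iota> x) \<le> norm x * K'"
    using bounded_linear.pos_bounded[OF \<iota>(1)] by blast
  have "norm (N (T (\<iota> x))) \<le> norm x * (K' * M * K)" if "x \<in> V'" for x
  proof -
    have "norm (N (T (\<iota> x))) \<le> norm (T (\<iota> x)) * K"
      by (rule K)
    also have "\<dots> \<le> M * norm (\<iota> x) * K"
      using M \<iota>(2)[OF that] K by (intro mult_right_mono) auto
    also have "\<dots> \<le> M * (norm x * K') * K"
      using M K K' by (intro mult_right_mono mult_left_mono) auto
    finally show ?thesis by (simp add: mult_ac)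
  qed
  then show ?thesis
    unfolding bounded_linear_on_def
    using bounded_linear_on_add[OF T] bounded_linear_on_scaleR[OF T] \<iota>(2)
    by (auto simp: linear_add[OF bounded_linear.linear] linear_scale[OF bounded_linear.linear] N \<iota>(1))
qed

lemma bounded_linear_on_plus:
  assumes "bounded_linear_on V T" "bounded_linear_on V T'"
  shows "bounded_linear_on V (\<lambda>x. T x + T' x)"
proof -
  obtain M where M: "0 < M" "\<And>x. x \<in> V \<Longrightarrow> norm (T x) \<le> M * norm x"
    using bounded_linear_on_pos_bounded[OF assms(1)] by blast
  obtain M' where M': "0 < M'" "\<And>x. x \<in> V \<Longrightarrow> norm (T' x) \<le> M' * norm x"
    using bounded_linear_on_pos_bounded[OF assms(2)] by blast
  have "norm (T x + T' x) \<le> norm x * (M + M')" if "x \<in> V" for x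
    using M(2)[OF that] M'(2)[OF that] norm_triangle_ineq[of "T x" "T' x"]
    by (simp add: algebra_simps)
  then show ?thesis
    using assms unfolding bounded_linear_on_def by (auto simp: scaleR_add_right)
qed

lemma bounded_linear_on_minus:
  "bounded_linear_on V T \<Longrightarrow> bounded_linear_on V (\<lambda>x. - T x)"
  unfolding bounded_linear_on_def by auto

lemma bounded_linear_on_sum:
  assumes "finite I" "\<And>i. i \<in> I \<Longrightarrow> bounded_linear_on V (T i)"
  shows "bounded_linear_on V (\<lambda>x. \<Sum>i\<in>I. T i x)"
  using assms
proof (induction I rule: finite_induct)
  case empty
  then show ?case by (auto simp: bounded_linear_on_def intro!: exI[of _ 0])
next
  case (insert i I)
  then show ?case by (simp add: bounded_linear_on_plus)
qed

text \<open>Norm convergence implies weak convergence, and sequences decide continuity here.\<close>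

lemma completely_continuous_on_imp_continuous_on:
  assumes V: "subspace V" and F: "completely_continuous_on V F"
  shows "continuous_on V F"
  unfolding continuous_on_sequentially
proof (intro allI impI ballI, elim conjE)
  fix s x
  assume x: "x \<in> V" and s: "\<forall>n. s n \<in> V" and lim: "s \<longlonglongrightarrow> x"
  have "(\<lambda>k. \<phi> (s k)) \<longlonglongrightarrow> \<phi> x" if "\<phi> \<in> dual_on V" for \<phi>
  proof -
    have \<phi>: "bounded_linear_on V \<phi>"
      using that by (simp add: dual_on_def)
    then obtain M where M: "0 < M" "\<And>x. x \<in> V \<Longrightarrow> norm (\<phi> x) \<le> M * norm x"
      using bounded_linear_on_pos_bounded by blast
    have "norm (\<phi> (s k) - \<phi> x) \<le> norm (s k - x) * M" for k
      using M(2)[of "s k - x"] subspace_diff[OF V] s x bounded_linear_on_diff[OF \<phi> V, of "s k" x]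
      by (simp add: mult.commute)
    moreover have "(\<lambda>k. norm (s k - x) * M) \<longlonglongrightarrow> 0"
      using lim by (intro tendsto_mult_left_zero tendsto_norm_zero LIM_zero)
    ultimately have "(\<lambda>k. \<phi> (s k) - \<phi> x) \<longlonglongrightarrow> 0"
      by (rule Lim_null_comparison[OF always_eventually[OF allI]])
    then show ?thesis by (simp add: LIM_zero_iff)
  qed
  then have "weakly_converges_on V s x"
    using s x by (simp add: weakly_converges_on_def)
  then show "(F \<circ> s) \<longlonglongrightarrow> F x"
    using F by (simp add: completely_continuous_on_def comp_def)
qed

lemma frechet_imp_point_derivative_on:
  assumes V: "subspace V" and x: "x \<in> V" and F: "has_frechet_derivative_on V F F' x"
  shows "point_derivative_on V F F' x"
  unfolding point_derivative_on_def
proof (intro allI impI)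
  fix \<epsilon> :: real
  assume "0 < \<epsilon>"
  have F': "bounded_linear_on V F'"
    and lim: "((\<lambda>h. (F (x + h) - F x - F' h) /\<^sub>R norm h) \<longlongrightarrow> 0) (at 0 within V)"
    using F by (auto simp: has_frechet_derivative_on_def)
  obtain \<delta> where \<delta>: "\<delta> > 0" "\<And>h. h \<in> V \<Longrightarrow> h \<noteq> 0 \<Longrightarrow> norm h < \<delta> \<Longrightarrow>
      norm ((F (x + h) - F x - F' h) /\<^sub>R norm h) < \<epsilon>"
    using lim \<open>0 < \<epsilon>\<close> unfolding Lim_within by (force simp: dist_norm)
  have "norm (F d - F x - F' (d - x)) \<le> \<epsilon> * norm (d - x)" if d: "d \<in> V" "norm (d - x) < \<delta>" for d
  proof (cases "d = x")
    case True
    then show ?thesis using bounded_linear_on_zero[OF F' V] by simp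
  next
    case False
    then have "norm ((F d - F x - F' (d - x)) /\<^sub>R norm (d - x)) < \<epsilon>"
      using \<delta>(2)[of "d - x"] d x subspace_diff[OF V] by simp
    then show ?thesis using False by (simp add: divide_simps mult.commute)
  qed
  then show "\<exists>\<delta>>0. \<forall>d\<in>V. norm (d - x) < \<delta> \<longrightarrow> norm (F d - F x - F' (d - x)) \<le> \<epsilon> * norm (d - x)"
    using \<delta>(1) by blast
qed

text \<open>The mean value inequality on a ball, which is convex, bounds the remainder by the
  oscillation of \<open>f'\<close> around \<open>f' x\<close>.\<close>

lemma continuous_derivative_imp_strict:
  fixes f :: "'a::real_normed_vector \<Rightarrow> 'b::real_normed_vector"
  assumes deriv: "\<And>y. (f has_derivative blinfun_apply (f' y)) (at y)"
    and cont: "continuous_on UNIV f'"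
  shows "strict_derivative_on UNIV f (blinfun_apply (f' x)) x"
  unfolding strict_derivative_on_def
proof (intro allI impI)
  fix \<epsilon> :: real
  assume "0 < \<epsilon>"
  then obtain \<delta> where \<delta>: "0 < \<delta>" "\<And>y. dist y x < \<delta> \<Longrightarrow> dist (f' y) (f' x) < \<epsilon>"
    using cont unfolding continuous_on_iff by (metis UNIV_I)
  have "norm (f b - f a - f' x (b - a)) \<le> norm (b - a) * \<epsilon>"
    if ab: "norm (a - x) < \<delta>" "norm (b - x) < \<delta>" for a b
  proof (rule differentiable_bound_linearization[where S = "ball x \<delta>"])
    fix t :: real
    assume "t \<in> {0..1}"
    then show "a + t *\<^sub>R (b - a) \<in> ball x \<delta>"
      using convexD_alt[OF convex_ball, of a x \<delta> b t] ab
      by (simp add: dist_norm norm_minus_commute algebra_simps)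
  next
    fix y
    assume "y \<in> ball x \<delta>"
    then have "norm (f' y - f' x) \<le> \<epsilon>"
      using \<delta>(2)[of y] by (simp add: dist_norm norm_minus_commute)
    then show "onorm (blinfun_apply (f' y) - blinfun_apply (f' x)) \<le> \<epsilon>"
      by (simp add: norm_blinfun.rep_eq minus_blinfun.rep_eq fun_diff_def)
  qed (use \<delta> deriv in \<open>auto intro: has_derivative_at_withinI\<close>)
  then show "\<exists>\<delta>>0. \<forall>d\<in>UNIV. \<forall>d'\<in>UNIV. norm (d - x) < \<delta> \<longrightarrow> norm (d' - x) < \<delta> \<longrightarrow>
      norm (f d' - f d - f' x (d' - d)) \<le> \<epsilon> * norm (d' - d)"
    using \<delta>(1) by (auto simp: mult.commute)
qed

text \<open>The error splits into the remainder of \<open>H\<close> along the increment of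
  \<open>F\<close>, and \<open>N\<close> applied to the remainder of \<open>F\<close>; each gets
  half of \<open>\<epsilon>\<close>. The first half uses that \<open>F\<close> is locally Lipschitz
  with constant \<open>M + 1\<close>.\<close>

lemma strict_derivative_on_comp:
  assumes F: "strict_derivative_on D F L x" and x: "x \<in> D"
    and M: "0 < M" "\<And>d d'. d \<in> D \<Longrightarrow> d' \<in> D \<Longrightarrow> norm (L (d' - d)) \<le> M * norm (d' - d)"
    and H: "strict_derivative_on UNIV H N (F x)" and N: "bounded_linear N"
  shows "strict_derivative_on D (\<lambda>d. H (F d)) (\<lambda>h. N (L h)) x"
  unfolding strict_derivative_on_def
proof (intro allI impI)
  fix \<epsilon> :: real
  assume \<epsilon>: "0 < \<epsilon>"
  obtain K where K: "0 < K" "\<And>x. norm (N x) \<le> norm x * K"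
    using bounded_linear.pos_bounded[OF N] by blast
  define \<epsilon>1 where "\<epsilon>1 = min 1 (\<epsilon> / (2 * K))"
  define M1 where "M1 = M + 1"
  have M1: "0 < M1" "M \<le> M1 - 1" using M by (auto simp: M1_def)
  have \<epsilon>1: "0 < \<epsilon>1" "\<epsilon>1 \<le> 1" "\<epsilon>1 * K \<le> \<epsilon> / 2"
    using \<epsilon> K by (auto simp: \<epsilon>1_def min_def field_simps)
  obtain \<delta>1 where \<delta>1: "0 < \<delta>1" "\<And>d d'. d \<in> D \<Longrightarrow> d' \<in> D \<Longrightarrow> norm (d - x) < \<delta>1 \<Longrightarrow>
      norm (d' - x) < \<delta>1 \<Longrightarrow> norm (F d' - F d - L (d' - d)) \<le> \<epsilon>1 * norm (d' - d)"
    using F \<epsilon>1(1) unfolding strict_derivative_on_def by metis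
  have "0 < \<epsilon> / (2 * M1)" using \<epsilon> M1 by simp
  then obtain \<delta>2 where \<delta>2: "0 < \<delta>2" "\<And>d d'. norm (d - F x) < \<delta>2 \<Longrightarrow>
      norm (d' - F x) < \<delta>2 \<Longrightarrow> norm (H d' - H d - N (d' - d)) \<le> \<epsilon> / (2 * M1) * norm (d' - d)"
    using H unfolding strict_derivative_on_def by (metis UNIV_I)
  have lip: "norm (F d' - F d) \<le> M1 * norm (d' - d)"
    if "d \<in> D" "d' \<in> D" "norm (d - x) < \<delta>1" "norm (d' - x) < \<delta>1" for d d'
  proof -
    have "norm (F d' - F d) \<le> norm (L (d' - d)) + norm (F d' - F d - L (d' - d))"
      by (rule norm_triangle_sub)
    also have "\<dots> \<le> M * norm (d' - d) + \<epsilon>1 * norm (d' - d)"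
      using M(2) \<delta>1(2) that by (intro add_mono) auto
    also have "\<dots> \<le> M1 * norm (d' - d)"
      using mult_right_mono[OF \<epsilon>1(2), of "norm (d' - d)"] by (simp add: M1_def algebra_simps)
    finally show ?thesis .
  qed
  define \<delta> where "\<delta> = min \<delta>1 (\<delta>2 / M1)"
  have \<delta>: "0 < \<delta>" "\<delta> \<le> \<delta>1" "M1 * \<delta> \<le> \<delta>2"
    using \<delta>1 \<delta>2 M1 by (auto simp: \<delta>_def min_def field_simps)
  have near: "norm (F d - F x) < \<delta>2" if "d \<in> D" "norm (d - x) < \<delta>" for d
  proof -
    have "norm (F d - F x) \<le> M1 * norm (d - x)"
      using lip[OF x that(1)] that \<delta> \<delta>1 by simp
    also have "\<dots> < M1 * \<delta>"
      using that M1 by simp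
    finally show ?thesis using \<delta> by simp
  qed
  have "norm (H (F d') - H (F d) - N (L (d' - d))) \<le> \<epsilon> * norm (d' - d)"
    if d: "d \<in> D" "d' \<in> D" "norm (d - x) < \<delta>" "norm (d' - x) < \<delta>" for d d'
  proof -
    have d1: "norm (d - x) < \<delta>1" "norm (d' - x) < \<delta>1"
      using d \<delta> by auto
    have "norm (H (F d') - H (F d) - N (F d' - F d)) \<le> \<epsilon> / (2 * M1) * norm (F d' - F d)"
      using \<delta>2(2) near d by blast
    also have "\<dots> \<le> \<epsilon> / (2 * M1) * (M1 * norm (d' - d))"
      using lip d d1 \<open>0 < \<epsilon> / (2 * M1)\<close> by (intro mult_left_mono) auto
    also have "\<dots> = \<epsilon> / 2 * norm (d' - d)"
      using M1 by simp
    finally have 1: "norm (H (F d') - H (F d) - N (F d' - F d)) \<le> \<epsilon> / 2 * norm (d' - d)" .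
    have "norm (N (F d' - F d - L (d' - d))) \<le> norm (F d' - F d - L (d' - d)) * K"
      by (rule K)
    also have "\<dots> \<le> \<epsilon>1 * norm (d' - d) * K"
      using \<delta>1(2) d d1 K by (intro mult_right_mono) auto
    also have "\<dots> \<le> \<epsilon> / 2 * norm (d' - d)"
      using mult_right_mono[OF \<epsilon>1(3), of "norm (d' - d)"] by (simp add: mult_ac)
    finally have 2: "norm (N (F d' - F d - L (d' - d))) \<le> \<epsilon> / 2 * norm (d' - d)" .
    have eq: "H (F d') - H (F d) - N (L (d' - d)) =
        (H (F d') - H (F d) - N (F d' - F d)) + N (F d' - F d - L (d' - d))"
      using linear_diff[OF bounded_linear.linear[OF N]] by simp
    show ?thesis
      unfolding eq using norm_triangle_le[OF add_mono[OF 1 2]] by simp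
  qed
  then show "\<exists>\<delta>>0. \<forall>d\<in>D. \<forall>d'\<in>D. norm (d - x) < \<delta> \<longrightarrow> norm (d' - x) < \<delta> \<longrightarrow>
      norm (H (F d') - H (F d) - N (L (d' - d))) \<le> \<epsilon> * norm (d' - d)"
    using \<delta>(1) by blast
qed

text \<open>The condition on differences says that \<open>r\<close> is affine with nonexpansive
  linear part \<open>\<iota>\<close>. It covers restriction to a smaller set and freezing all
  players but one, where \<open>\<iota>\<close> is \<open>axis i\<close>.\<close>

lemma strict_derivative_on_reparam:
  assumes F: "strict_derivative_on D F L (r x)" and x: "x \<in> D'"
    and r: "\<And>d. d \<in> D' \<Longrightarrow> r d \<in> D"
    and \<iota>: "\<And>d d'. d \<in> D' \<Longrightarrow> d' \<in> D' \<Longrightarrow> r d' - r d = \<iota> (d' - d)"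
      "\<And>h. norm (\<iota> h) \<le> norm h"
  shows "strict_derivative_on D' (\<lambda>d. F (r d)) (\<lambda>h. L (\<iota> h)) x"
  unfolding strict_derivative_on_def
proof (intro allI impI)
  fix \<epsilon> :: real
  assume \<epsilon>: "0 < \<epsilon>"
  obtain \<delta> where \<delta>: "0 < \<delta>" "\<And>d d'. d \<in> D \<Longrightarrow> d' \<in> D \<Longrightarrow> norm (d - r x) < \<delta> \<Longrightarrow>
      norm (d' - r x) < \<delta> \<Longrightarrow> norm (F d' - F d - L (d' - d)) \<le> \<epsilon> * norm (d' - d)"
    using F \<epsilon> unfolding strict_derivative_on_def by metis
  have le: "norm (r d' - r d) \<le> norm (d' - d)" if "d \<in> D'" "d' \<in> D'" for d d'
    using \<iota> that by simp
  have "norm (F (r d') - F (r d) - L (\<iota> (d' - d))) \<le> \<epsilon> * norm (d' - d)"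
    if d: "d \<in> D'" "d' \<in> D'" "norm (d - x) < \<delta>" "norm (d' - x) < \<delta>" for d d'
  proof -
    have "norm (F (r d') - F (r d) - L (r d' - r d)) \<le> \<epsilon> * norm (r d' - r d)"
      using \<delta>(2) r le[OF x] d by (meson le_less_trans)
    also have "\<dots> \<le> \<epsilon> * norm (d' - d)"
      using le d \<epsilon> by simp
    finally show ?thesis
      using \<iota>(1) d by simp
  qed
  then show "\<exists>\<delta>>0. \<forall>d\<in>D'. \<forall>d'\<in>D'. norm (d - x) < \<delta> \<longrightarrow> norm (d' - x) < \<delta> \<longrightarrow>
      norm (F (r d') - F (r d) - L (\<iota> (d' - d))) \<le> \<epsilon> * norm (d' - d)"
    using \<delta>(1) by blast
qed

lemma point_derivative_on_reparam:
  assumes F: "point_derivative_on D F L (r x)" and x: "x \<in> D'"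
    and r: "\<And>d. d \<in> D' \<Longrightarrow> r d \<in> D"
    and \<iota>: "\<And>d. d \<in> D' \<Longrightarrow> r d - r x = \<iota> (d - x)"
      "\<And>h. norm (\<iota> h) \<le> norm h"
  shows "point_derivative_on D' (\<lambda>d. F (r d)) (\<lambda>h. L (\<iota> h)) x"
  unfolding point_derivative_on_def
proof (intro allI impI)
  fix \<epsilon> :: real
  assume \<epsilon>: "0 < \<epsilon>"
  obtain \<delta> where \<delta>: "0 < \<delta>" "\<And>d. d \<in> D \<Longrightarrow> norm (d - r x) < \<delta> \<Longrightarrow>
      norm (F d - F (r x) - L (d - r x)) \<le> \<epsilon> * norm (d - r x)"
    using F \<epsilon> unfolding point_derivative_on_def by metis
  have "norm (F (r d) - F (r x) - L (\<iota> (d - x))) \<le> \<epsilon> * norm (d - x)"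
    if d: "d \<in> D'" "norm (d - x) < \<delta>" for d
  proof -
    have le: "norm (r d - r x) \<le> norm (d - x)"
      using \<iota> d by simp
    then have "norm (F (r d) - F (r x) - L (r d - r x)) \<le> \<epsilon> * norm (r d - r x)"
      using \<delta>(2) r d by (meson le_less_trans)
    also have "\<dots> \<le> \<epsilon> * norm (d - x)"
      using le \<epsilon> by simp
    finally show ?thesis
      using \<iota>(1) d by simp
  qed
  then show "\<exists>\<delta>>0. \<forall>d\<in>D'. norm (d - x) < \<delta> \<longrightarrow>
      norm (F (r d) - F (r x) - L (\<iota> (d - x))) \<le> \<epsilon> * norm (d - x)"
    using \<delta>(1) by blast
qed

lemma point_derivative_on_plus:
  assumes F: "point_derivative_on D F L x" and G: "point_derivative_on D G M x"
  shows "point_derivative_on D (\<lambda>d. F d + G d) (\<lambda>h. L h + M h) x"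
  unfolding point_derivative_on_def
proof (intro allI impI)
  fix \<epsilon> :: real
  assume "0 < \<epsilon>"
  then have \<epsilon>: "0 < \<epsilon> / 2" by simp
  obtain \<delta> where \<delta>: "0 < \<delta>" "\<And>d. d \<in> D \<Longrightarrow> norm (d - x) < \<delta> \<Longrightarrow>
      norm (F d - F x - L (d - x)) \<le> \<epsilon> / 2 * norm (d - x)"
    using F \<epsilon> unfolding point_derivative_on_def by metis
  obtain \<delta>' where \<delta>': "0 < \<delta>'" "\<And>d. d \<in> D \<Longrightarrow> norm (d - x) < \<delta>' \<Longrightarrow>
      norm (G d - G x - M (d - x)) \<le> \<epsilon> / 2 * norm (d - x)"
    using G \<epsilon> unfolding point_derivative_on_def by metis
  have "norm (F d + G d - (F x + G x) - (L (d - x) + M (d - x))) \<le> \<epsilon> * norm (d - x)"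
    if "d \<in> D" "norm (d - x) < min \<delta> \<delta>'" for d
  proof -
    have "norm ((F d - F x - L (d - x)) + (G d - G x - M (d - x))) \<le> \<epsilon> / 2 * norm (d - x) + \<epsilon> / 2 * norm (d - x)"
      using \<delta>(2)[of d] \<delta>'(2)[of d] that by (intro norm_triangle_le add_mono) auto
    then show ?thesis by (simp add: algebra_simps)
  qed
  then show "\<exists>\<delta>>0. \<forall>d\<in>D. norm (d - x) < \<delta> \<longrightarrow>
      norm (F d + G d - (F x + G x) - (L (d - x) + M (d - x))) \<le> \<epsilon> * norm (d - x)"
    using \<delta>(1) \<delta>'(1) by (intro exI[of _ "min \<delta> \<delta>'"]) auto
qed

lemma point_derivative_on_sum:
  assumes "finite I" "\<And>i. i \<in> I \<Longrightarrow> point_derivative_on D (F i) (L i) x"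
  shows "point_derivative_on D (\<lambda>d. \<Sum>i\<in>I. F i d) (\<lambda>h. \<Sum>i\<in>I. L i h) x"
  using assms
proof (induction I rule: finite_induct)
  case empty
  then show ?case by (auto simp: point_derivative_on_def intro!: exI[of _ 1])
next
  case (insert i I)
  then show ?case by (simp add: point_derivative_on_plus)
qed

text \<open>
  Continuity of \<open>S\<close> is assumed, so no inverse function theorem is needed; for the solution
  operator it follows from complete continuity.
\<close>

lemma strict_derivative_on_right_inverse:
  fixes S :: "'a::real_normed_vector \<Rightarrow> 'b::real_normed_vector"
    and I :: "'c::real_normed_vector \<Rightarrow>\<^sub>L 'b"
  assumes A: "strict_derivative_on UNIV A (blinfun_apply A') (S x)"
    and I: "I o\<^sub>L A' = id_blinfun"
    and S: "continuous_on D S" and x: "x \<in> D"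
    and AS: "\<And>d d'. d \<in> D \<Longrightarrow> d' \<in> D \<Longrightarrow> A (S d') - A (S d) = B (d' - d)"
    and M: "0 < M" "\<And>d d'. d \<in> D \<Longrightarrow> d' \<in> D \<Longrightarrow> norm (B (d' - d)) \<le> M * norm (d' - d)"
  shows "strict_derivative_on D S (\<lambda>h. I (B h)) x"
  unfolding strict_derivative_on_def
proof (intro allI impI)
  fix \<epsilon> :: real
  assume \<epsilon>: "0 < \<epsilon>"
  define K where "K = norm I + 1"
  have K: "0 < K" "norm (I z) \<le> K * norm z" for z
  proof -
    show "0 < K" by (simp add: K_def add_nonneg_pos)
    show "norm (I z) \<le> K * norm z"
      using norm_blinfun[of I z] by (simp add: K_def algebra_simps add_increasing)
  qed
  \<comment> \<open>The first entry lets \<open>norm z\<close> be absorbed, giving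
    \<open>norm z \<le> 2 * norm (I (B (d' - d)))\<close>; the second turns the resulting bound into
    \<open>\<epsilon> * norm (d' - d)\<close>.\<close>
  define \<epsilon>0 where "\<epsilon>0 = min (1 / (2 * K)) (\<epsilon> / (2 * K * K * M))"
  have "0 < \<epsilon>0" "\<epsilon>0 \<le> 1 / (2 * K)" "\<epsilon>0 \<le> \<epsilon> / (2 * K * K * M)"
    using \<epsilon> K M by (auto simp: \<epsilon>0_def)
  then have \<epsilon>0: "0 < \<epsilon>0" "K * \<epsilon>0 \<le> 1 / 2" "K * \<epsilon>0 * (2 * K * M) \<le> \<epsilon>"
    using K M by (auto simp: pos_le_divide_eq mult_ac)
  obtain \<delta>0 where \<delta>0: "0 < \<delta>0" "\<And>y y'. norm (y - S x) < \<delta>0 \<Longrightarrow> norm (y' - S x) < \<delta>0 \<Longrightarrow>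
      norm (A y' - A y - A' (y' - y)) \<le> \<epsilon>0 * norm (y' - y)"
    using A \<epsilon>0(1) unfolding strict_derivative_on_def by (metis UNIV_I)
  obtain \<delta> where \<delta>: "0 < \<delta>" "\<And>d. d \<in> D \<Longrightarrow> norm (d - x) < \<delta> \<Longrightarrow> norm (S d - S x) < \<delta>0"
    using S x \<delta>0(1) unfolding continuous_on_iff dist_norm by metis
  have "norm (S d' - S d - I (B (d' - d))) \<le> \<epsilon> * norm (d' - d)"
    if d: "d \<in> D" "d' \<in> D" "norm (d - x) < \<delta>" "norm (d' - x) < \<delta>" for d d'
  proof -
    define z where "z = S d' - S d"
    have "I (A' z) = z"
      using I by (metis blinfun_apply_blinfun_compose id_blinfun.rep_eq id_apply)
    \<comment> \<open>Since \<open>B (d' - d)\<close> is the increment of \<open>A\<close> between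
      the two states, the remainder of \<open>S\<close> is, up to sign, \<open>I\<close> applied to
      the remainder of \<open>A\<close>.\<close>
    then have "z - I (B (d' - d)) = - I (B (d' - d) - A' z)"
      by (simp add: blinfun.diff_right)
    then have "norm (z - I (B (d' - d))) \<le> K * norm (B (d' - d) - A' z)"
      using K(2) by simp
    also have "\<dots> \<le> K * (\<epsilon>0 * norm z)"
      using \<delta>0(2)[of "S d" "S d'"] \<delta>(2) d AS K by (intro mult_left_mono) (auto simp: z_def)
    finally have *: "norm (z - I (B (d' - d))) \<le> K * \<epsilon>0 * norm z"
      by (simp add: mult_ac)
    also have "\<dots> \<le> 1 / 2 * norm z"
      using \<epsilon>0 by (intro mult_right_mono) auto
    finally have "norm z \<le> 2 * norm (I (B (d' - d)))"
      using norm_triangle_sub[of z "I (B (d' - d))"] by simp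
    also have "\<dots> \<le> 2 * (K * (M * norm (d' - d)))"
      using order_trans[OF K(2) mult_left_mono[OF M(2)[OF d(1,2)], of K]] K(1) by simp
    finally have "K * \<epsilon>0 * norm z \<le> K * \<epsilon>0 * (2 * (K * (M * norm (d' - d))))"
      using K \<epsilon>0 by (intro mult_left_mono) auto
    also have "\<dots> = K * \<epsilon>0 * (2 * K * M) * norm (d' - d)"
      by (simp add: mult_ac)
    also have "\<dots> \<le> \<epsilon> * norm (d' - d)"
      using \<epsilon>0(3) by (rule mult_right_mono) simp
    finally show ?thesis
      using * by (simp add: z_def)
  qed
  then show "\<exists>\<delta>>0. \<forall>d\<in>D. \<forall>d'\<in>D. norm (d - x) < \<delta> \<longrightarrow> norm (d' - x) < \<delta> \<longrightarrow>
      norm (S d' - S d - I (B (d' - d))) \<le> \<epsilon> * norm (d' - d)"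
    using \<delta>(1) by blast
qed

subsection \<open>Cone constraints and product strategies\<close>

text \<open>On \<open>C \<times> K\<close> the abstract rule gives one inequality in two free
  variables. Fixing \<open>v = u\<close> yields the sign of \<open>\<mu>\<close> and
  complementarity, fixing \<open>k = g u\<close> yields stationarity.\<close>

theorem cone_constrained_multiplier:
  fixes V C :: "'a::banach set" and g :: "'a \<Rightarrow> 'x::banach"
  assumes V: "subspace V" and C: "C \<subseteq> V" "closed C" "convex C" "u \<in> C"
    and K: "closed K" "convex K" "cone K" "g u \<in> K"
    and T: "bounded_linear_on V T" and g: "strict_derivative_on C g T u"
    and regular: "{T h - k |h k. h \<in> radial_cone C u \<and> k \<in> cone_at K (g u)} = UNIV"
    and \<phi>': "bounded_linear_on V \<phi>'" and \<phi>: "point_derivative_on C \<phi> \<phi>' u"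
    and minimal: "\<And>v. v \<in> C \<Longrightarrow> g v \<in> K \<Longrightarrow> \<phi> u \<le> (\<phi> v :: real)"
  obtains \<mu> where "\<mu> \<in> dual_cone K" "blinfun_apply \<mu> (g u) = 0"
    "\<And>v. v \<in> C \<Longrightarrow> blinfun_apply \<mu> (T (v - u)) \<le> \<phi>' (v - u)"
proof -
  define L where "L z = T (fst z) - snd z" for z
  define F where "F z = g (fst z) - snd z" for z
  have K_add: "x + y \<in> K" if "x \<in> K" "y \<in> K" for x y
    using that K(2,3) convex_cone by blast
  have K_scale: "c *\<^sub>R x \<in> K" if "x \<in> K" "0 \<le> c" for c x
    using that K(3) by (simp add: cone_def)
  interpret regular_point "V \<times> UNIV" "C \<times> K" L "(u, g u)"
  proof
    show "subspace (V \<times> (UNIV :: 'x set))"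
      using V by (simp add: subspace_Times)
    show "bounded_linear_on (V \<times> UNIV) L"
    proof -
      have "bounded_linear_on (V \<times> UNIV) (\<lambda>z. - snd z :: 'x)"
        by (auto simp: bounded_linear_on_def norm_snd_le intro!: exI[of _ 1])
      moreover have "bounded_linear_on (V \<times> (UNIV :: 'x set)) (\<lambda>z. T (fst z))"
        by (rule bounded_linear_on_comp[OF T bounded_linear_ident bounded_linear_fst]) auto
      ultimately have "bounded_linear_on (V \<times> UNIV) (\<lambda>z. T (fst z) + - snd z)"
        by (intro bounded_linear_on_plus)
      then show ?thesis by (simp add: L_def[abs_def])
    qed
    fix y
    obtain h k where hk: "y = T h - k" "h \<in> radial_cone C u" "k \<in> cone_at K (g u)"
      using regular by (force simp: set_eq_iff)
    obtain \<alpha> c where c: "h = \<alpha> *\<^sub>R (c - u)" "c \<in> C" "0 \<le> \<alpha>"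
      using hk(2) unfolding radial_cone_def by blast
    obtain k0 \<beta> where k0: "k = k0 - \<beta> *\<^sub>R g u" "k0 \<in> K" "0 \<le> \<beta>"
      using hk(3) unfolding cone_at_def by blast
    \<comment> \<open>The locale wants one factor for both coordinates, while the hypothesis
      supplies separate \<open>\<alpha>\<close> and \<open>\<beta>\<close>. \<open>\<gamma>\<close>
      dominates both, so \<open>c'\<close> stays on a segment in \<open>C\<close> and
      \<open>k'\<close> is a nonnegative combination in \<open>K\<close>; the summand 1 makes it
      positive.\<close>
    define \<gamma> where "\<gamma> = \<alpha> + \<beta> + 1"
    have \<gamma>: "0 < \<gamma>" "\<alpha> \<le> \<gamma>" "\<beta> \<le> \<gamma>"
      using c k0 by (auto simp: \<gamma>_def)
    define c' where "c' = u + (\<alpha> / \<gamma>) *\<^sub>R (c - u)"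
    define k' where "k' = ((\<gamma> - \<beta>) / \<gamma>) *\<^sub>R g u + (1 / \<gamma>) *\<^sub>R k0"
    have "c' \<in> C"
      using convexD_alt[OF C(3,4) c(2), of "\<alpha> / \<gamma>"] c \<gamma> by (simp add: c'_def algebra_simps)
    moreover have "k' \<in> K"
      unfolding k'_def using K(4) k0 \<gamma> by (intro K_add K_scale) auto
    moreover have "\<gamma> *\<^sub>R (c' - u) = h"
      using \<gamma> by (simp add: c'_def c)
    moreover have "\<gamma> *\<^sub>R (k' - g u) = k"
    proof -
      have "\<gamma> *\<^sub>R (k' - g u) = \<gamma> *\<^sub>R k' - \<gamma> *\<^sub>R g u"
        by (rule scaleR_right_diff_distrib)
      also have "\<gamma> *\<^sub>R k' = (\<gamma> - \<beta>) *\<^sub>R g u + k0"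
        using \<gamma> by (simp add: k'_def scaleR_right_distrib)
      finally show ?thesis
        by (simp add: k0 scaleR_left_diff_distrib)
    qed
    ultimately show "\<exists>\<alpha>\<ge>0. \<exists>d\<in>C \<times> K. y = L (\<alpha> *\<^sub>R (d - (u, g u)))"
      using \<gamma> hk by (intro exI[of _ \<gamma>] conjI bexI[of _ "(c', k')"]) (auto simp: L_def)
  qed (use C K in \<open>auto simp: closed_Times convex_Times\<close>)
  have "strict_derivative_on (C \<times> K) F L (u, g u)"
    unfolding strict_derivative_on_def
  proof (intro allI impI)
    fix \<epsilon> :: real
    assume \<epsilon>: "0 < \<epsilon>"
    obtain \<delta> where \<delta>: "0 < \<delta>" "\<And>d d'. d \<in> C \<Longrightarrow> d' \<in> C \<Longrightarrow> norm (d - u) < \<delta> \<Longrightarrow>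
        norm (d' - u) < \<delta> \<Longrightarrow> norm (g d' - g d - T (d' - d)) \<le> \<epsilon> * norm (d' - d)"
      using g \<epsilon> unfolding strict_derivative_on_def by metis
    have "norm (F z' - F z - L (z' - z)) \<le> \<epsilon> * norm (z' - z)"
      if z: "z \<in> C \<times> K" "z' \<in> C \<times> K" "norm (z - (u, g u)) < \<delta>" "norm (z' - (u, g u)) < \<delta>" for z z'
    proof -
      have le: "norm (fst w) \<le> norm w" for w :: "'a \<times> 'x"
        using norm_fst_le[of "fst w" "snd w"] by simp
      have "F z' - F z - L (z' - z) = g (fst z') - g (fst z) - T (fst z' - fst z)"
        by (simp add: F_def L_def)
      moreover have "norm (fst z - u) < \<delta>" "norm (fst z' - u) < \<delta>"
        using le[of "z - (u, g u)"] le[of "z' - (u, g u)"] z by auto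
      ultimately have "norm (F z' - F z - L (z' - z)) \<le> \<epsilon> * norm (fst z' - fst z)"
        using \<delta>(2)[of "fst z" "fst z'"] z by auto
      also have "\<dots> \<le> \<epsilon> * norm (z' - z)"
        using le[of "z' - z"] \<epsilon> by simp
      finally show ?thesis .
    qed
    then show "\<exists>\<delta>>0. \<forall>z\<in>C \<times> K. \<forall>z'\<in>C \<times> K. norm (z - (u, g u)) < \<delta> \<longrightarrow>
        norm (z' - (u, g u)) < \<delta> \<longrightarrow> norm (F z' - F z - L (z' - z)) \<le> \<epsilon> * norm (z' - z)"
      using \<delta>(1) by blast
  qed
  moreover have "F (u, g u) = 0"
    by (simp add: F_def)
  moreover have "bounded_linear_on (V \<times> (UNIV :: 'x set)) (\<lambda>z. \<phi>' (fst z))"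
    by (rule bounded_linear_on_comp[OF \<phi>' bounded_linear_ident bounded_linear_fst]) auto
  moreover have "point_derivative_on (C \<times> K) (\<lambda>z. \<phi> (fst z)) (\<lambda>z. \<phi>' (fst z)) (u, g u)"
    using \<phi> C K by (intro point_derivative_on_reparam[where D = C and r = fst and \<iota> = fst and F = \<phi> and L = "\<phi>'"])
      (auto simp: fst_diff norm_fst_le)
  moreover have "\<phi> (fst (u, g u)) \<le> \<phi> (fst z)" if "z \<in> C \<times> K" "F z = 0" for z
    using that minimal[of "fst z"] by (auto simp: F_def)
  ultimately have "\<exists>\<mu>. \<forall>z\<in>C \<times> K. blinfun_apply \<mu> (L (z - (u, g u))) \<le> \<phi>' (fst (z - (u, g u)))"
    by (rule lagrange_multiplier) blast+
  then obtain \<mu> where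
    \<mu>: "\<And>z. z \<in> C \<times> K \<Longrightarrow> blinfun_apply \<mu> (L (z - (u, g u))) \<le> \<phi>' (fst (z - (u, g u)))"
    by blast
  have "0 \<le> \<mu> (k - g u)" if "k \<in> K" for k
    using \<mu>[of "(u, k)"] that C(4) bounded_linear_on_zero[OF T V] bounded_linear_on_zero[OF \<phi>' V]
    by (simp add: L_def blinfun.minus_right blinfun.diff_right)
  then have ge: "\<mu> (g u) \<le> \<mu> k" if "k \<in> K" for k
    using that by (simp add: blinfun.diff_right)
  \<comment> \<open>\<open>g u\<close> minimizes \<open>\<mu>\<close> over the cone; comparison with
    the multiples 0 and 2 of \<open>g u\<close> forces the value 0.\<close>
  have "\<mu> (g u) \<le> 0"
    using ge[OF K_scale[OF K(4), of 0]] by (simp add: blinfun.zero_right)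
  moreover have "0 \<le> \<mu> (g u)"
    using ge[OF K_scale[OF K(4), of 2]] by (simp add: blinfun.scaleR_right)
  ultimately have zero: "\<mu> (g u) = 0"
    by simp
  show thesis
  proof (rule that)
    show "\<mu> \<in> dual_cone K"
      using ge zero by (simp add: dual_cone_def)
    show "\<mu> (T (v - u)) \<le> \<phi>' (v - u)" if "v \<in> C" for v
      using \<mu>[of "(v, g u)"] that K(4) by (simp add: L_def)
  qed (rule zero)
qed

section \<open>Product strategy sets and unilateral deviations\<close>

lemma subspace_prod_set: "(\<And>i. subspace (E i)) \<Longrightarrow> subspace (prod_set E)"
  by (auto simp: prod_set_def subspace_def)

lemma closed_prod_set:
  fixes C :: "'n::finite \<Rightarrow> 'e::topological_space set"
  assumes "\<And>i. closed (C i)"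
  shows "closed (prod_set C)"
proof -
  have "prod_set C = (\<Inter>i. (\<lambda>u. u $ i) -` C i)"
    by (auto simp: prod_set_def)
  then show ?thesis
    using assms by (auto intro!: closed_INT continuous_closed_vimage continuous_intros)
qed

lemma convex_prod_set: "(\<And>i. convex (C i)) \<Longrightarrow> convex (prod_set C)"
  by (auto simp: prod_set_def convex_def)

lemma norm_axis_eq: "norm (axis i x :: 'a::real_normed_vector ^ 'n) = norm x"
proof -
  have "(\<Sum>j\<in>UNIV. (norm ((axis i x :: 'a ^ 'n) $ j))\<^sup>2) = (\<Sum>j\<in>{i}. (norm x)\<^sup>2)"
    by (rule sum.mono_neutral_cong_right) (auto simp: axis_def)
  then show ?thesis
    by (simp add: norm_vec_def L2_set_def)
qed

lemma bounded_linear_axis: "bounded_linear (axis i :: 'a::real_normed_vector \<Rightarrow> 'a ^ 'n)"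
proof (rule bounded_linear_intro[where K = 1])
  show "norm (axis i x :: 'a ^ 'n) \<le> norm x * 1" for x :: 'a
    by (simp add: norm_axis_eq)
qed (auto simp: axis_def vec_eq_iff)

lemma axis_in_prod_set: "(\<And>i. subspace (E i)) \<Longrightarrow> h \<in> E i \<Longrightarrow> axis i h \<in> prod_set E"
  by (auto simp: prod_set_def axis_def subspace_0)

lemma replace_in_prod_set: "u \<in> prod_set C \<Longrightarrow> v \<in> C i \<Longrightarrow> replace u i v \<in> prod_set C"
  by (auto simp: prod_set_def replace_def)

lemma replace_self: "replace u i (u $ i) = u"
  by (simp add: replace_def vec_eq_iff)

lemma replace_diff:
  fixes u :: "'e::ab_group_add ^ 'n"
  shows "replace u i v' - replace u i v = axis i (v' - v)"
  by (simp add: replace_def axis_def vec_eq_iff)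

lemma replace_diff_self:
  fixes u :: "'e::ab_group_add ^ 'n"
  shows "replace u i v - u = axis i (v - u $ i)"
  using replace_diff[of u i v "u $ i"] by (simp add: replace_self)

theorem corollary32:
  fixes E :: "'n::finite \<Rightarrow> 'e::banach set"
    and A :: "'y::banach \<Rightarrow> 'w::banach"
    and DA :: "'y \<Rightarrow> 'y \<Rightarrow>\<^sub>L 'w" and DA_inv :: "'y \<Rightarrow> 'w \<Rightarrow>\<^sub>L 'y"
    and f :: 'w
    and B :: "'e ^ 'n \<Rightarrow> 'w"
    and S :: "'e ^ 'n \<Rightarrow> 'y"
    and emb :: "'y \<Rightarrow>\<^sub>L 'x::banach"
    and K :: "'x set"
    and G :: "'y \<Rightarrow> 'x" and DG :: "'y \<Rightarrow> 'y \<Rightarrow>\<^sub>L 'x"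
    and g :: "'e ^ 'n \<Rightarrow> 'x"
    and Uad :: "'n \<Rightarrow> 'e set"
    and J1 :: "'n \<Rightarrow> 'y \<Rightarrow> real" and DJ1 :: "'n \<Rightarrow> 'y \<Rightarrow> 'y \<Rightarrow>\<^sub>L real"
    and J2 :: "'n \<Rightarrow> 'e \<Rightarrow> real" and DJ2 :: "'n \<Rightarrow> 'e \<Rightarrow> 'e \<Rightarrow> real"
  assumes E_subspace: "\<And>i. subspace (E i)" and E_closed: "\<And>i. closed (E i)"
    and E_reflexive: "\<And>i. reflexive_on (E i)"
    and E_separable: "\<And>i. separable_space (top_of_set (E i))"
    and Y_reflexive: "reflexive_on (UNIV :: 'y set)"
    and W_reflexive: "reflexive_on (UNIV :: 'w set)"
    and embedding: "inj (blinfun_apply emb)"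
    and A_bij: "bij A"
    and A_deriv: "\<And>y. (A has_derivative blinfun_apply (DA y)) (at y)"
    and DA_cont: "continuous_on UNIV DA"
    and DA_inv_left: "\<And>y. DA_inv y o\<^sub>L DA y = id_blinfun"
    and DA_inv_right: "\<And>y. DA y o\<^sub>L DA_inv y = id_blinfun"
    and DA_inv_bounded: "\<And>M. bounded M \<Longrightarrow> bounded (DA_inv ` M)"
    and B_bounded_linear: "bounded_linear_on (prod_set E) B"
    and S_eq: "S = (\<lambda>u. inv A (f + B u))"
    and S_compl_cont: "completely_continuous_on (prod_set E) S"
    and K_cone: "K \<noteq> {}" "closed K" "convex K" "cone K"
    and G_deriv: "\<And>y. (G has_derivative blinfun_apply (DG y)) (at y)"
    and DG_cont: "continuous_on UNIV DG"
    and g_eq: "g = G \<circ> S"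
    and Uad_subset: "\<And>i. Uad i \<subseteq> E i"
    and Uad_nonempty: "\<And>i. Uad i \<noteq> {}" and Uad_bounded: "\<And>i. bounded (Uad i)"
    and Uad_closed: "\<And>i. closed (Uad i)" and Uad_convex: "\<And>i. convex (Uad i)"
    and feasible_nonempty: "feasible_set Uad g K \<noteq> {}"
    and J1_compl_cont: "\<And>i. completely_continuous_on UNIV (J1 i)"
    and J1_below: "\<And>i. bdd_below (range (J1 i))"
    and J1_deriv: "\<And>i y. (J1 i has_derivative blinfun_apply (DJ1 i y)) (at y)"
    and DJ1_cont: "\<And>i. continuous_on UNIV (DJ1 i)"
    and J2_cont: "\<And>i. continuous_on (E i) (J2 i)"
    and J2_weakly_lsc: "\<And>i. weakly_lsc_on (E i) (J2 i)"
    and J2_below: "\<And>i. bdd_below (J2 i ` E i)"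
    and J2_C1: "\<And>i. continuously_differentiable_on (E i) (J2 i) (DJ2 i)"
    and DJ2_graph: "\<And>i. weak_weakstar_closed_graph_on (E i) (DJ2 i)"
  shows
    "(\<forall>u y. nash_equilibrium Uad g K S J1 J2 u \<and> y = S u \<and>
        (\<forall>i. {blinfun_apply (DG y) (blinfun_apply (DA_inv y) (B (axis i h))) - k |h k.
                h \<in> radial_cone (Uad i) (u $ i) \<and> k \<in> cone_at K (G y)} = UNIV)
      \<longrightarrow> (\<exists>(p :: 'n \<Rightarrow> 'w \<Rightarrow>\<^sub>L real) (\<mu> :: 'n \<Rightarrow> 'x \<Rightarrow>\<^sub>L real) (lam :: 'n \<Rightarrow> 'e \<Rightarrow> real).
            \<forall>i. lam i \<in> dual_on (E i) \<and>
              (\<forall>h\<in>E i. 0 = DJ2 i (u $ i) h + blinfun_apply (p i) (B (axis i h)) + lam i h) \<and>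
              A y = f + B u \<and>
              p i o\<^sub>L DA y = DJ1 i y - (\<mu> i o\<^sub>L DG y) \<and>
              lam i \<in> normal_cone_on (E i) (Uad i) (u $ i) \<and>
              \<mu> i \<in> dual_cone K \<and> G y \<in> K \<and> blinfun_apply (\<mu> i) (G y) = 0)) \<and>
     (\<forall>u y. variational_equilibrium Uad g K S J1 J2 u \<and> y = S u \<and>
        {blinfun_apply (DG y) (blinfun_apply (DA_inv y) (B h)) - k |h k.
           h \<in> radial_cone (prod_set Uad) u \<and> k \<in> cone_at K (G y)} = UNIV
      \<longrightarrow> (\<exists>(p :: 'n \<Rightarrow> 'w \<Rightarrow>\<^sub>L real) (\<mu> :: 'x \<Rightarrow>\<^sub>L real) (lam :: 'n \<Rightarrow> 'e \<Rightarrow> real).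
            \<forall>i. lam i \<in> dual_on (E i) \<and>
              (\<forall>h\<in>E i. 0 = DJ2 i (u $ i) h + blinfun_apply (p i) (B (axis i h)) + lam i h) \<and>
              A y = f + B u \<and>
              p i o\<^sub>L DA y = DJ1 i y - (\<mu> o\<^sub>L DG y) \<and>
              lam i \<in> normal_cone_on (E i) (Uad i) (u $ i) \<and>
              \<mu> \<in> dual_cone K \<and> G y \<in> K \<and> blinfun_apply \<mu> (G y) = 0))"
proof -

  \<comment> \<open>Derivatives of the solution operator, the constraint and the objectives\<close>
  have E: "subspace (prod_set E)"
    using E_subspace by (rule subspace_prod_set)
  have axis_E: "axis i h \<in> prod_set E" if "h \<in> E i" for i h
    using E_subspace that by (rule axis_in_prod_set)
  have AS: "A (S u) = f + B u" for u
    using A_bij by (simp add: S_eq bij_is_surj surj_f_inv_f)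
  obtain M where M: "0 < M" "\<And>h. h \<in> prod_set E \<Longrightarrow> norm (B h) \<le> M * norm h"
    using bounded_linear_on_pos_bounded[OF B_bounded_linear] by blast
  have Uad_E: "v \<in> prod_set E" if "v \<in> prod_set Uad" for v
    using that Uad_subset by (auto simp: prod_set_def)
  \<comment> \<open>At \<open>y = S u\<close> this is the derivative of \<open>S\<close> at
    \<open>u\<close>, obtained by differentiating \<open>A (S u) = f + B u\<close>.\<close>
  define T where "T y h = blinfun_apply (DA_inv y) (B h)" for y h
  have S_strict: "strict_derivative_on (prod_set E) S (T (S u)) u" if u: "u \<in> prod_set E" for u
    unfolding T_def
  proof (rule strict_derivative_on_right_inverse)
    show "strict_derivative_on UNIV A (blinfun_apply (DA (S u))) (S u)"
      using A_deriv DA_cont by (rule continuous_derivative_imp_strict)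
    show "continuous_on (prod_set E) S"
      using E S_compl_cont by (rule completely_continuous_on_imp_continuous_on)
    show "A (S d') - A (S d) = B (d' - d)" if "d \<in> prod_set E" "d' \<in> prod_set E" for d d'
      using bounded_linear_on_diff[OF B_bounded_linear E that(2,1)] by (simp add: AS)
    show "norm (B (d' - d)) \<le> M * norm (d' - d)" if "d \<in> prod_set E" "d' \<in> prod_set E" for d d'
      using that by (intro M subspace_diff[OF E])
  qed (rule DA_inv_left u M)+
  have T_linear: "bounded_linear_on (prod_set E) (T y)" for y
    unfolding T_def
    by (rule bounded_linear_on_comp[OF B_bounded_linear blinfun.bounded_linear_right bounded_linear_ident])
  \<comment> \<open>Polymorphic in the target, so that the same chain rule serves \<open>G\<close>
    and every \<open>J1 i\<close>.\<close>
  have comp_strict: "strict_derivative_on (prod_set E) (\<lambda>v. H (S v)) (\<lambda>h. blinfun_apply (H' (S u)) (T (S u) h)) u"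
    if u: "u \<in> prod_set E" and H: "\<And>y. (H has_derivative blinfun_apply (H' y)) (at y)" "continuous_on UNIV H'"
    for H :: "'y \<Rightarrow> 'z::real_normed_vector" and H' u
  proof -
    obtain M where "0 < M" "\<And>h. h \<in> prod_set E \<Longrightarrow> norm (T (S u) h) \<le> M * norm h"
      using bounded_linear_on_pos_bounded[OF T_linear] by blast
    then show ?thesis
      using subspace_diff[OF E]
      by (intro strict_derivative_on_comp[OF S_strict[OF u] u _ _
            continuous_derivative_imp_strict[OF H] blinfun.bounded_linear_right, of M]) auto
  qed
  have g_strict: "strict_derivative_on (prod_set E) g (\<lambda>h. DG (S u) (T (S u) h)) u"
    if "u \<in> prod_set E" for u
    using comp_strict[OF that G_deriv DG_cont] by (simp add: g_eq comp_def)
  have J1_point: "point_derivative_on (prod_set E) (\<lambda>v. J1 i (S v)) (\<lambda>h. DJ1 i (S u) (T (S u) h)) u"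
    if "u \<in> prod_set E" for u i
    using comp_strict[OF that J1_deriv DJ1_cont] that by (rule strict_imp_point_derivative_on)
  have J2_frechet: "has_frechet_derivative_on (E i) (J2 i) (DJ2 i x) x" if "x \<in> E i" for i x
    using J2_C1 that unfolding continuously_differentiable_on_def by blast
  then have DJ2_linear: "bounded_linear_on (E i) (DJ2 i x)" if "x \<in> E i" for i x
    using that unfolding has_frechet_derivative_on_def by blast
  have J2_point: "point_derivative_on (E i) (J2 i) (DJ2 i x) x" if "x \<in> E i" for i x
    using E_subspace that J2_frechet[OF that] by (rule frechet_imp_point_derivative_on)
  \<comment> \<open>Shared by both kinds of equilibrium. \<open>p\<close> solves the adjoint
    equation and \<open>lam\<close> is the residual of the gradient equation, so both equations hold
    by construction; the remaining claim, that \<open>lam\<close> is normal, is the inequality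
    \<open>stationary\<close> rearranged.\<close>
  have kkt: "\<exists>p lam. lam \<in> dual_on (E i) \<and>
      (\<forall>h\<in>E i. 0 = DJ2 i (u $ i) h + blinfun_apply p (B (axis i h)) + lam h) \<and>
      A y = f + B u \<and> p o\<^sub>L DA y = DJ1 i y - (\<mu> o\<^sub>L DG y) \<and>
      lam \<in> normal_cone_on (E i) (Uad i) (u $ i) \<and>
      \<mu> \<in> dual_cone K \<and> G y \<in> K \<and> blinfun_apply \<mu> (G y) = 0"
    if u: "u \<in> prod_set Uad" and y: "y = S u"
      and \<mu>: "\<mu> \<in> dual_cone K" "G y \<in> K" "blinfun_apply \<mu> (G y) = 0"
      and stationary: "\<And>v. v \<in> Uad i \<Longrightarrow> blinfun_apply \<mu> (DG y (T y (axis i (v - u $ i))))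
          \<le> DJ1 i y (T y (axis i (v - u $ i))) + DJ2 i (u $ i) (v - u $ i)"
    for u y i \<mu>
  proof -
    define p where "p = (DJ1 i y - (\<mu> o\<^sub>L DG y)) o\<^sub>L DA_inv y"
    define lam where "lam h = - (DJ2 i (u $ i) h + blinfun_apply p (B (axis i h)))" for h
    have p_B: "blinfun_apply p (B h) = DJ1 i y (T y h) - blinfun_apply \<mu> (DG y (T y h))" for h
      by (simp add: p_def T_def blinfun.diff_left)
    have "u $ i \<in> E i"
      using u Uad_subset by (auto simp: prod_set_def)
    moreover have "bounded_linear_on (E i) (\<lambda>h. blinfun_apply p (B (axis i h)))"
      by (rule bounded_linear_on_comp[OF B_bounded_linear blinfun.bounded_linear_right
            bounded_linear_axis axis_E])
    ultimately have lam: "bounded_linear_on (E i) lam"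
      unfolding lam_def using DJ2_linear by (intro bounded_linear_on_minus bounded_linear_on_plus)
    have "DA_inv y (DA y h) = h" for h
      using DA_inv_left[of y] by (metis blinfun_apply_blinfun_compose id_blinfun.rep_eq id_apply)
    then have "p o\<^sub>L DA y = DJ1 i y - (\<mu> o\<^sub>L DG y)"
      by (intro blinfun_eqI) (simp add: p_def)
    moreover have "lam (v - u $ i) \<le> 0" if "v \<in> Uad i" for v
      using stationary[OF that] by (simp add: lam_def p_B)
    ultimately show ?thesis
      using lam \<mu> AS[of u] y
      by (intro exI[of _ p] exI[of _ lam]) (auto simp: dual_on_def normal_cone_on_def lam_def)
  qed
  show ?thesis
  proof (intro conjI allI impI; elim conjE)

    \<comment> \<open>Nash equilibria: one multiplier per player\<close>
    fix u y
    assume nash: "nash_equilibrium Uad g K S J1 J2 u" and y: "y = S u"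
      and regular: "\<forall>i. {blinfun_apply (DG y) (blinfun_apply (DA_inv y) (B (axis i h))) - k |h k.
        h \<in> radial_cone (Uad i) (u $ i) \<and> k \<in> cone_at K (G y)} = UNIV"
    have u: "u \<in> prod_set Uad" "u \<in> prod_set E" and gu: "g u = G y" "G y \<in> K"
      using nash Uad_E by (auto simp: nash_equilibrium_def g_eq y)
    have ui: "u $ i \<in> Uad i" "u $ i \<in> E i" for i
      using u by (auto simp: prod_set_def)
    have "\<exists>\<mu> p lam. lam \<in> dual_on (E i) \<and>
        (\<forall>h\<in>E i. 0 = DJ2 i (u $ i) h + blinfun_apply p (B (axis i h)) + lam h) \<and>
        A y = f + B u \<and> p o\<^sub>L DA y = DJ1 i y - (\<mu> o\<^sub>L DG y) \<and>
        lam \<in> normal_cone_on (E i) (Uad i) (u $ i) \<and>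
        \<mu> \<in> dual_cone K \<and> G y \<in> K \<and> blinfun_apply \<mu> (G y) = 0" for i
    proof -
      \<comment> \<open>Player \<open>i\<close> solves a problem on \<open>E i\<close> alone. The
        map \<open>?r\<close> is affine with isometric linear part \<open>axis i\<close>, so
        derivatives on the product restrict along it.\<close>
      let ?r = "replace u i"
      have r: "?r v \<in> prod_set E" if "v \<in> Uad i" for v
        using u(2) that Uad_subset by (intro replace_in_prod_set) auto
      have "\<exists>\<mu>\<in>dual_cone K. blinfun_apply \<mu> (g (?r (u $ i))) = 0 \<and>
          (\<forall>v\<in>Uad i. blinfun_apply \<mu> (DG y (T y (axis i (v - u $ i))))
             \<le> DJ1 i y (T y (axis i (v - u $ i))) + DJ2 i (u $ i) (v - u $ i))"
      proof (rule cone_constrained_multiplier[where V = "E i" and C = "Uad i" and u = "u $ i" and K = K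
            and g = "\<lambda>v. g (?r v)" and T = "\<lambda>h. DG y (T y (axis i h))"
            and \<phi> = "\<lambda>v. J1 i (S (?r v)) + J2 i v"
            and \<phi>' = "\<lambda>h. DJ1 i y (T y (axis i h)) + DJ2 i (u $ i) h"])
        show "bounded_linear_on (E i) (\<lambda>h. DG y (T y (axis i h)))"
          by (rule bounded_linear_on_comp[OF T_linear blinfun.bounded_linear_right
                bounded_linear_axis axis_E])
        show "strict_derivative_on (Uad i) (\<lambda>v. g (?r v)) (\<lambda>h. DG y (T y (axis i h))) (u $ i)"
          by (rule strict_derivative_on_reparam[where D = "prod_set E" and r = ?r and F = g
                and L = "\<lambda>h. DG y (T y h)" and \<iota> = "axis i"])
            (use g_strict[OF u(2)] r ui in \<open>simp_all add: replace_self replace_diff norm_axis_eq y\<close>)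
        show "{DG y (T y (axis i h)) - k |h k. h \<in> radial_cone (Uad i) (u $ i) \<and>
            k \<in> cone_at K (g (?r (u $ i)))} = UNIV"
          using regular by (simp add: T_def replace_self gu)
        show "bounded_linear_on (E i) (\<lambda>h. DJ1 i y (T y (axis i h)) + DJ2 i (u $ i) h)"
          by (intro bounded_linear_on_plus DJ2_linear ui bounded_linear_on_comp[OF T_linear
                blinfun.bounded_linear_right bounded_linear_axis axis_E])
        show "point_derivative_on (Uad i) (\<lambda>v. J1 i (S (?r v)) + J2 i v)
            (\<lambda>h. DJ1 i y (T y (axis i h)) + DJ2 i (u $ i) h) (u $ i)"
        proof (rule point_derivative_on_plus)
          show "point_derivative_on (Uad i) (\<lambda>v. J1 i (S (?r v)))
              (\<lambda>h. DJ1 i y (T y (axis i h))) (u $ i)"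
            by (rule point_derivative_on_reparam[where D = "prod_set E" and r = ?r
                  and F = "\<lambda>v. J1 i (S v)" and L = "\<lambda>h. DJ1 i y (T y h)" and \<iota> = "axis i"])
              (use J1_point[OF u(2)] r ui in \<open>simp_all add: replace_self replace_diff_self norm_axis_eq y\<close>)
          show "point_derivative_on (Uad i) (J2 i) (DJ2 i (u $ i)) (u $ i)"
            by (rule point_derivative_on_reparam[where D = "E i" and r = "\<lambda>v. v"
                  and F = "J2 i" and L = "DJ2 i (u $ i)" and \<iota> = "\<lambda>h. h"])
              (use J2_point[OF ui(2)] ui subsetD[OF Uad_subset] in auto)
        qed
        show "J1 i (S (?r (u $ i))) + J2 i (u $ i) \<le> J1 i (S (?r v)) + J2 i v"
          if "v \<in> Uad i" "g (?r v) \<in> K" for v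
          using nash that by (force simp: nash_equilibrium_def is_arg_min_def not_less)
      qed (use E_subspace Uad_subset Uad_closed Uad_convex K_cone ui gu in
          \<open>auto simp: replace_self\<close>)
      then show ?thesis
        using kkt[OF u(1) y] gu by (simp add: replace_self) blast
    qed
    then show "\<exists>p \<mu> lam. \<forall>i. lam i \<in> dual_on (E i) \<and>
        (\<forall>h\<in>E i. 0 = DJ2 i (u $ i) h + blinfun_apply (p i) (B (axis i h)) + lam i h) \<and>
        A y = f + B u \<and> p i o\<^sub>L DA y = DJ1 i y - (\<mu> i o\<^sub>L DG y) \<and>
        lam i \<in> normal_cone_on (E i) (Uad i) (u $ i) \<and>
        \<mu> i \<in> dual_cone K \<and> G y \<in> K \<and> blinfun_apply (\<mu> i) (G y) = 0"
      by metis
  next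

    \<comment> \<open>Variational equilibria: a common multiplier\<close>
    fix u y
    assume var: "variational_equilibrium Uad g K S J1 J2 u" and y: "y = S u"
      and regular: "{blinfun_apply (DG y) (blinfun_apply (DA_inv y) (B h)) - k |h k.
        h \<in> radial_cone (prod_set Uad) u \<and> k \<in> cone_at K (G y)} = UNIV"
    have u: "u \<in> prod_set Uad" "u \<in> prod_set E" and gu: "g u = G y" "G y \<in> K"
      using var Uad_E
      by (auto simp: variational_equilibrium_def is_arg_min_def feasible_set_def g_eq y)
    have ui: "u $ i \<in> Uad i" "u $ i \<in> E i" for i
      using u by (auto simp: prod_set_def)
    \<comment> \<open>The opponents stay frozen at \<open>u\<close> inside the i-th summand, which
      thus depends on \<open>v $ i\<close> only. This makes \<open>\<phi>'\<close> split by players,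
      although the constraint on \<open>v\<close> remains joint.\<close>
    define \<phi> where "\<phi> v = (\<Sum>i\<in>UNIV. J1 i (S (replace u i (v $ i))) + J2 i (v $ i))" for v
    define \<phi>' where "\<phi>' h = (\<Sum>i\<in>UNIV. DJ1 i y (T y (axis i (h $ i))) + DJ2 i (u $ i) (h $ i))" for h
    have "\<exists>\<mu>\<in>dual_cone K. blinfun_apply \<mu> (g u) = 0 \<and>
        (\<forall>v\<in>prod_set Uad. blinfun_apply \<mu> (DG y (T y (v - u))) \<le> \<phi>' (v - u))"
    proof (rule cone_constrained_multiplier[where V = "prod_set E" and C = "prod_set Uad" and u = u
          and K = K and g = g and T = "\<lambda>h. DG y (T y h)" and \<phi> = \<phi> and \<phi>' = \<phi>'])
      show "bounded_linear_on (prod_set E) (\<lambda>h. DG y (T y h))"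
        by (rule bounded_linear_on_comp[OF T_linear blinfun.bounded_linear_right bounded_linear_ident])
      show "strict_derivative_on (prod_set Uad) g (\<lambda>h. DG y (T y h)) u"
        by (rule strict_derivative_on_reparam[where D = "prod_set E" and r = "\<lambda>v. v" and F = g
              and L = "\<lambda>h. DG y (T y h)" and \<iota> = "\<lambda>h. h"])
          (use g_strict[OF u(2)] u Uad_E in \<open>simp_all add: y\<close>)
      show "{DG y (T y h) - k |h k. h \<in> radial_cone (prod_set Uad) u \<and> k \<in> cone_at K (g u)} = UNIV"
        using regular by (simp add: T_def gu)
      have nth_E: "h $ i \<in> E i" if "h \<in> prod_set E" for h i
        using that by (simp add: prod_set_def)
      have axis_nth: "bounded_linear (\<lambda>h :: 'e ^ 'n. axis i (h $ i) :: 'e ^ 'n)" for i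
        by (rule bounded_linear_compose[OF bounded_linear_axis bounded_linear_vec_nth])
      show "bounded_linear_on (prod_set E) \<phi>'"
        unfolding \<phi>'_def
      proof (intro bounded_linear_on_sum bounded_linear_on_plus)
        show "bounded_linear_on (prod_set E) (\<lambda>h. DJ1 i y (T y (axis i (h $ i))))" for i
          by (rule bounded_linear_on_comp[OF T_linear blinfun.bounded_linear_right axis_nth axis_E[OF nth_E]])
        show "bounded_linear_on (prod_set E) (\<lambda>h. DJ2 i (u $ i) (h $ i))" for i
          by (rule bounded_linear_on_comp[OF DJ2_linear[OF ui(2)] bounded_linear_ident
                bounded_linear_vec_nth nth_E])
      qed simp
      show "point_derivative_on (prod_set Uad) \<phi> \<phi>' u"
        unfolding \<phi>_def \<phi>'_def
      proof (intro point_derivative_on_sum point_derivative_on_plus)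
        show "point_derivative_on (prod_set Uad) (\<lambda>v. J1 i (S (replace u i (v $ i))))
            (\<lambda>h. DJ1 i y (T y (axis i (h $ i)))) u" for i
        proof (rule point_derivative_on_reparam[where D = "prod_set E" and r = "\<lambda>v. replace u i (v $ i)"
              and F = "\<lambda>v. J1 i (S v)" and L = "\<lambda>h. DJ1 i y (T y h)" and \<iota> = "\<lambda>h. axis i (h $ i)"])
          show "replace u i (v $ i) \<in> prod_set E" if "v \<in> prod_set Uad" for v
            using u(2) nth_E[OF Uad_E[OF that]] by (rule replace_in_prod_set)
        qed (use J1_point[OF u(2)] u in
            \<open>simp_all add: replace_self replace_diff_self norm_axis_eq y Finite_Cartesian_Product.norm_nth_le\<close>)
        show "point_derivative_on (prod_set Uad) (\<lambda>v. J2 i (v $ i)) (\<lambda>h. DJ2 i (u $ i) (h $ i)) u" for i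
          by (rule point_derivative_on_reparam[where D = "E i" and r = "\<lambda>v. v $ i"
                and F = "J2 i" and L = "DJ2 i (u $ i)" and \<iota> = "\<lambda>h. h $ i"])
            (use J2_point[OF ui(2)] u nth_E Uad_E in \<open>simp_all add: Finite_Cartesian_Product.norm_nth_le\<close>)
      qed simp
      show "\<phi> u \<le> \<phi> v" if "v \<in> prod_set Uad" "g v \<in> K" for v
        using var that unfolding \<phi>_def
        by (force simp: variational_equilibrium_def is_arg_min_def not_less feasible_set_def)
    qed (use E Uad_E Uad_closed Uad_convex K_cone u gu in
        \<open>auto intro: closed_prod_set convex_prod_set\<close>)
    then obtain \<mu> where \<mu>: "\<mu> \<in> dual_cone K" "blinfun_apply \<mu> (G y) = 0"
      "\<And>v. v \<in> prod_set Uad \<Longrightarrow> blinfun_apply \<mu> (DG y (T y (v - u))) \<le> \<phi>' (v - u)"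
      using gu by auto
    \<comment> \<open>All summands with \<open>j \<noteq> i\<close> see the zero direction and
      vanish by linearity.\<close>
    have \<phi>'_axis: "\<phi>' (axis i h) = DJ1 i y (T y (axis i h)) + DJ2 i (u $ i) h" for i h
    proof -
      have "T y (axis j 0) = 0" for j
        using bounded_linear_on_zero[OF T_linear E] linear_0[OF bounded_linear.linear[OF bounded_linear_axis]]
        by metis
      then have "DJ1 j y (T y (axis j (axis i h $ j))) + DJ2 j (u $ j) (axis i h $ j) =
          (if j = i then DJ1 i y (T y (axis i h)) + DJ2 i (u $ i) h else 0)" for j
        using bounded_linear_on_zero[OF DJ2_linear[OF ui(2)] E_subspace] by (simp add: axis_def)
      then show ?thesis
        by (simp add: \<phi>'_def)
    qed
    \<comment> \<open>The joint inequality holds on all of \<open>prod_set Uad\<close>, which as a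
      product contains every unilateral change of \<open>u\<close>. Each such test isolates one
      player while \<open>\<mu>\<close> stays the same.\<close>
    have "blinfun_apply \<mu> (DG y (T y (axis i (v - u $ i))))
        \<le> DJ1 i y (T y (axis i (v - u $ i))) + DJ2 i (u $ i) (v - u $ i)" if "v \<in> Uad i" for i v
      using \<mu>(3)[OF replace_in_prod_set[OF u(1) that]] by (simp add: replace_diff_self \<phi>'_axis)
    then show "\<exists>p \<mu> lam. \<forall>i. lam i \<in> dual_on (E i) \<and>
        (\<forall>h\<in>E i. 0 = DJ2 i (u $ i) h + blinfun_apply (p i) (B (axis i h)) + lam i h) \<and>
        A y = f + B u \<and> p i o\<^sub>L DA y = DJ1 i y - (\<mu> o\<^sub>L DG y) \<and>
        lam i \<in> normal_cone_on (E i) (Uad i) (u $ i) \<and>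
        \<mu> \<in> dual_cone K \<and> G y \<in> K \<and> blinfun_apply \<mu> (G y) = 0"
      using kkt[OF u(1) y \<mu>(1) gu(2) \<mu>(2)] by metis
  qed
qed

end
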